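(* Let $0<r_0<r_1<r_2$, $p(r)=\frac1r$, $\rho(r)=\frac1r\left(\frac{r^2}{r_0^2}-1\right)$ on $[r_1,r_2]$. Consider the Sturm–Liouville eigenvalue problem $$-\frac{d}{dr}\left(p(r)\frac{dR}{dr}\right)=\lambda^2\rho(r)R,\qquad R(r_1)=R(r_2)=0,$$ with eigenvalues $0<\lambda_1^2\le\lambda_2^2\le\cdots$ ($\lambda_m>0$) and corresponding eigenfunctions $\{R_m\}_{m\ge1}$, orthonormal in $L^2_\rho(r_1,r_2)$. Set $$w(r)=\frac12\left(r\sqrt{\frac{r^2}{r_0^2}-1}-r_0\ln\frac{r+\sqrt{r^2-r_0^2}}{r_0}\right),\qquad \xi(r)=\int_{r_1}^r\sqrt{\frac{\rho(s)}{p(s)}}\,ds,\qquad L=\xi(r_2).$$ Then $\xi(r)=w(r)-w(r_1)$, so that $L=w(r_2)-w(r_1)$, and as $m\to\infty$ $$\lambda_m=\frac{\pi m}{L}+O(m^{-1}).$$ The eigenfunctions admit the leading asymptotic representation $$R_m(r)\sim\frac{1}{(p(r)\rho(r))^{1/4}}\sin\left(\lambda_m\xi(r)\right),\qquad m\to\infty,$$ uniformly for $r\in[r_1,r_2]$, up to normalization; and, for the orthonormal eigenfunctions, $$R_m(r)=\sqrt{\frac2L}\,\frac{1}{(p(r)\rho(r))^{1/4}}\sin\left(\frac{\pi m}{L}\xi(r)\right)+O(m^{-1}),\qquad m\to\infty,$$ uniformly for $r\in[r_1,r_2]$.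
   Context: $L^2_\rho(r_1,r_2)$ is the weighted Hilbert space with scalar product $\langle f,g\rangle_\rho=\int_{r_1}^{r_2}\rho f\overline g\,dr$. The eigenvalue problem is a regular self-adjoint Sturm–Liouville problem, so it has a discrete sequence of positive eigenvalues tending to infinity, with eigenfunctions forming a complete orthonormal basis of $L^2_\rho(r_1,r_2)$.
   Formalization: Orthonormal eigenfunctions are fixed only up to a unimodular factor (a sign if real), so the last formula is proved with such a factor σ_m multiplying the leading term; without it the formula fails, e.g. for (-1)^m R_m. *)

theory Defs
  imports "HOL-Analysis.Analysis" "HOL-Library.Landau_Symbols"
begin

(* Functions on [a,b] are rendered as total functions on the reals whose values outside
   [a,b] are irrelevant; derivatives at the endpoints are one-sided. *)

definition sl_solution ::
  "(real \<Rightarrow> real) \<Rightarrow> (real \<Rightarrow> real) \<Rightarrow> real \<Rightarrow> real \<Rightarrow> real \<Rightarrow> (real \<Rightarrow> complex) \<Rightarrow> bool" where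
  "sl_solution p \<rho> a b \<mu> f \<longleftrightarrow>
     (\<exists>f'. \<forall>r\<in>{a..b}.
        (f has_vector_derivative f' r) (at r within {a..b}) \<and>
        ((\<lambda>s. p s *\<^sub>R f' s) has_vector_derivative - (\<mu> * \<rho> r) *\<^sub>R f r) (at r within {a..b}))"

definition sl_eigenfunction ::
  "(real \<Rightarrow> real) \<Rightarrow> (real \<Rightarrow> real) \<Rightarrow> real \<Rightarrow> real \<Rightarrow> real \<Rightarrow> (real \<Rightarrow> complex) \<Rightarrow> bool" where
  "sl_eigenfunction p \<rho> a b \<mu> f \<longleftrightarrow>
     sl_solution p \<rho> a b \<mu> f \<and> f a = 0 \<and> f b = 0 \<and> (\<exists>r\<in>{a..b}. f r \<noteq> 0)"

definition sl_eigenvalue ::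
  "(real \<Rightarrow> real) \<Rightarrow> (real \<Rightarrow> real) \<Rightarrow> real \<Rightarrow> real \<Rightarrow> real \<Rightarrow> bool" where
  "sl_eigenvalue p \<rho> a b \<mu> \<longleftrightarrow> (\<exists>f. sl_eigenfunction p \<rho> a b \<mu> f)"

definition weighted_inner ::
  "(real \<Rightarrow> real) \<Rightarrow> real \<Rightarrow> real \<Rightarrow> (real \<Rightarrow> complex) \<Rightarrow> (real \<Rightarrow> complex) \<Rightarrow> complex" where
  "weighted_inner \<rho> a b f g = integral {a..b} (\<lambda>r. complex_of_real (\<rho> r) * f r * cnj (g r))"

(* The values at index 0 are irrelevant.  Orthonormality prevents a value from being listed
   more often than its multiplicity; since the eigenvalues of this problem are simple,
   requiring every eigenvalue to occur makes this the list counted with multiplicity. *)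
definition sl_eigensystem ::
  "(real \<Rightarrow> real) \<Rightarrow> (real \<Rightarrow> real) \<Rightarrow> real \<Rightarrow> real \<Rightarrow> (nat \<Rightarrow> real) \<Rightarrow> (nat \<Rightarrow> real \<Rightarrow> complex) \<Rightarrow> bool" where
  "sl_eigensystem p \<rho> a b \<mu> R \<longleftrightarrow>
     (\<forall>m\<ge>1. sl_eigenfunction p \<rho> a b (\<mu> m) (R m)) \<and>
     (\<forall>m\<ge>1. \<forall>n\<ge>m. \<mu> m \<le> \<mu> n) \<and>
     (\<forall>\<nu>. sl_eigenvalue p \<rho> a b \<nu> \<longrightarrow> (\<exists>m\<ge>1. \<mu> m = \<nu>)) \<and>
     (\<forall>m\<ge>1. \<forall>n\<ge>1. weighted_inner \<rho> a b (R m) (R n) = (if m = n then 1 else 0))"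

definition p_coeff :: "real \<Rightarrow> real" where
  "p_coeff r = 1 / r"

definition rho_weight :: "real \<Rightarrow> real \<Rightarrow> real" where
  "rho_weight r0 r = (1 / r) * (r^2 / r0^2 - 1)"

definition w_fun :: "real \<Rightarrow> real \<Rightarrow> real" where
  "w_fun r0 r = (1/2) * (r * sqrt (r^2 / r0^2 - 1) - r0 * ln ((r + sqrt (r^2 - r0^2)) / r0))"

definition xi_fun :: "real \<Rightarrow> real \<Rightarrow> real \<Rightarrow> real" where
  "xi_fun r0 r1 r = integral {r1..r} (\<lambda>s. sqrt (rho_weight r0 s / p_coeff s))"

definition amplitude :: "real \<Rightarrow> real \<Rightarrow> real" where
  "amplitude r0 r = 1 / (p_coeff r * rho_weight r0 r) powr (1/4)"

end

(* Each eigenfunction is a multiple of the solution U of the equation with U(r1) = 0 and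
   (p U')(r1) = 1, which is a power series in mu = kappa^2, so the eigenvalues are the zeros of
   U(r2).  With B = (p rho)^(1/4), omega = sqrt(rho/p) and u = B U, v = u' / omega, the
   equation becomes u' = omega v, v' = -(kappa^2 - q) omega u with a bounded potential q, and
   the Pruefer angle Theta of the pair (v, kappa u) satisfies
   Theta' = kappa omega - (kappa q omega u^2) / (v^2 + kappa^2 u^2) = kappa omega + O(1/kappa).
   Hence Theta = kappa xi + O(1/kappa) uniformly in r, while v^2 + kappa^2 u^2 is constant up
   to a factor 1 + O(1/kappa); both together give the asymptotic form of u.  The eigenvalue
   condition is that Theta(r2) is a multiple of pi.  By the Lagrange identity Theta(r2) crosses
   every such multiple upwards as kappa grows, and it lies in (0, pi) for small kappa, so the
   m-th eigenvalue is exactly the solution of Theta(r2) = m pi. *)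

theory Submission
  imports Defs
begin

section \<open>Increments, Gronwall bounds and upward crossings\<close>

text \<open>The list \<open>lam\<close> is given only as some nondecreasing orthonormal enumeration,
  so the delicate point is the index: a shift by one in the multiple of pi would destroy the O(1/m)
  statement. The angle at the right end is not shown to be monotone in \<kappa>; its direction is
  controlled only where it is a multiple of pi. That suffices, because a continuous function that
  passes a level upwards at every contact never returns to it.

  The power series for \<open>U\<close> has majorants that are uniform for bounded \<mu>, so
  \<open>U\<close> and \<open>P\<close> are jointly continuous in \<mu> and r; continuity of
  \<Theta> in \<kappa> and of the Lagrange integral in \<mu> rests on this.

  Scaling the second component to \<kappa> u makes the part without q a pure rotation at speed
  \<kappa> \<omega>, so that q enters angle and logarithm of the modulus only with a factor
  1/\<kappa>. This becomes 1/m once the angle condition has forced linear growth of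
  \<open>lam\<close>. The constant sqrt (2/L) stems from the mean value 1/2 of the squared sine in
  the normalisation integral.\<close>

lemma nonneg_deriv_imp_le:
  fixes f :: "real \<Rightarrow> real"
  assumes f: "\<And>x. x \<in> {a..b} \<Longrightarrow> (f has_real_derivative f' x) (at x within {a..b})"
    and nn: "\<And>x. x \<in> {a..b} \<Longrightarrow> 0 \<le> f' x"
    and st: "a \<le> s" "s \<le> t" "t \<le> b"
  shows "f s \<le> f t"
proof (cases "s = t")
  case False
  then have "s < t" using st by simp
  have "(f has_derivative (*) (f' x)) (at x within {s..t})" if "s \<le> x" "x \<le> t" for x
    using has_field_derivative_subset[OF f[of x], of "{s..t}"] that st
    by (auto simp: has_field_derivative_def)
  from mvt_simple[OF \<open>s < t\<close> this] obtain x
    where "x \<in> {s<..<t}" "f t - f s = f' x * (t - s)" by blast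
  moreover have "0 \<le> f' x * (t - s)" using nn[of x] calculation(1) st by simp
  ultimately show ?thesis by simp
qed simp

text \<open>Both \<open>g - f\<close> and \<open>g + f\<close> are nondecreasing. This takes the
  place of estimates of integrals: the series coefficients, the angle and the normalisation integral
  are all bounded by exhibiting a comparison function \<open>g\<close>.\<close>

lemma abs_deriv_le_imp_abs_diff_le:
  fixes f :: "real \<Rightarrow> real"
  assumes f: "\<And>x. x \<in> {a..b} \<Longrightarrow> (f has_real_derivative f' x) (at x within {a..b})"
    and g: "\<And>x. x \<in> {a..b} \<Longrightarrow> (g has_real_derivative g' x) (at x within {a..b})"
    and le: "\<And>x. x \<in> {a..b} \<Longrightarrow> \<bar>f' x\<bar> \<le> g' x"
    and st: "a \<le> s" "s \<le> t" "t \<le> b"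
  shows "\<bar>f t - f s\<bar> \<le> g t - g s"
proof -
  have "g s - f s \<le> g t - f t"
    using st le
    by (intro nonneg_deriv_imp_le[where f = "\<lambda>x. g x - f x" and f' = "\<lambda>x. g' x - f' x"])
      (auto intro!: DERIV_diff f g simp: abs_le_iff)
  moreover have "g s + f s \<le> g t + f t"
    using st le
    by (intro nonneg_deriv_imp_le[where f = "\<lambda>x. g x + f x" and f' = "\<lambda>x. g' x + f' x"])
      (force intro!: DERIV_add f g simp: abs_le_iff)+
  ultimately show ?thesis by linarith
qed

lemma continuous_on_Icc_abs_bound:
  fixes f :: "real \<Rightarrow> real"
  assumes "continuous_on {a..b} f"
  obtains K where "0 \<le> K" "\<And>x. x \<in> {a..b} \<Longrightarrow> \<bar>f x\<bar> \<le> K"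
proof -
  obtain B where "\<And>x. x \<in> {a..b} \<Longrightarrow> \<bar>f x\<bar> \<le> B"
    using compact_imp_bounded[OF compact_continuous_image[OF assms]]
    unfolding bounded_iff by fastforce
  then show thesis by (intro that[of "max B 0"]) fastforce+
qed

text \<open>The product of \<open>e\<close> with \<open>exp (- K * (x - a))\<close> is
  nonincreasing. The signs of \<open>K\<close> and \<open>e\<close> are left free, so the lower
  bound below is the case of \<open>- e\<close> and \<open>- K\<close>.\<close>

lemma gronwall_upper:
  fixes e :: "real \<Rightarrow> real"
  assumes e: "\<And>x. x \<in> {a..b} \<Longrightarrow> (e has_real_derivative e' x) (at x within {a..b})"
    and le: "\<And>x. x \<in> {a..b} \<Longrightarrow> e' x \<le> K * e x"
    and r: "r \<in> {a..b}"
  shows "e r \<le> e a * exp (K * (r - a))"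
proof -
  have "- (e a * exp (- K * (a - a))) \<le> - (e r * exp (- K * (r - a)))"
  proof (rule nonneg_deriv_imp_le[where f = "\<lambda>x. - (e x * exp (- K * (x - a)))" and a = a and b = b
        and f' = "\<lambda>x. (K * e x - e' x) * exp (- K * (x - a))"])
    show "((\<lambda>x. - (e x * exp (- K * (x - a)))) has_real_derivative
        (K * e x - e' x) * exp (- K * (x - a))) (at x within {a..b})" if "x \<in> {a..b}" for x
      by (rule derivative_eq_intros refl e that)+ (simp add: algebra_simps)
  qed (use le r in auto)
  then have "e r * exp (- K * (r - a)) * exp (K * (r - a)) \<le> e a * exp (K * (r - a))"
    by (intro mult_right_mono) auto
  then show ?thesis
    by (simp add: mult.assoc flip: exp_add)
qed

lemma gronwall_lower:
  fixes e :: "real \<Rightarrow> real"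
  assumes e: "\<And>x. x \<in> {a..b} \<Longrightarrow> (e has_real_derivative e' x) (at x within {a..b})"
    and le: "\<And>x. x \<in> {a..b} \<Longrightarrow> - K * e x \<le> e' x"
    and r: "r \<in> {a..b}"
  shows "e a * exp (- K * (r - a)) \<le> e r"
  using gronwall_upper[of a b "\<lambda>x. - e x" "\<lambda>x. - e' x" "-K" r] assms
  by (fastforce intro!: DERIV_minus)

text \<open>At a first return to the level \<open>c\<close> the function would come from above,
  whereas \<open>left\<close> says that it comes from below. Applied twice: to the angle as a
  function of r at level 0, and to the angle at the right end as a function of \<kappa>.\<close>

lemma upcrossing_stays_above:
  fixes f :: "real \<Rightarrow> real"
  assumes cont: "continuous_on {s..t} f" and "s < t" and "c \<le> f s"
    and right: "\<And>x. x \<in> {s..<t} \<Longrightarrow> f x = c \<Longrightarrow> eventually (\<lambda>y. c < f y) (at_right x)"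
    and left: "\<And>x. x \<in> {s<..t} \<Longrightarrow> f x = c \<Longrightarrow> eventually (\<lambda>y. f y < c) (at_left x)"
  shows "c < f t"
proof (rule ccontr)
  assume ft: "\<not> c < f t"
  \<comment> \<open>The start may lie exactly on the level; \<open>right\<close> then supplies a
    later point strictly above it, from which a first return can be sought.\<close>
  obtain s' where s': "s \<le> s'" "s' < t" "c < f s'"
  proof (cases "f s = c")
    case True
    then obtain d where "d > s" "\<And>y. s < y \<Longrightarrow> y < d \<Longrightarrow> c < f y"
      using right[of s] \<open>s < t\<close> by (auto simp: eventually_at_right_field)
    moreover obtain y where "s < y" "y < min d t"
      using dense[of s "min d t"] \<open>s < t\<close> calculation by auto
    ultimately show ?thesis by (intro that[of y]) auto
  next
    case False
    then show ?thesis using assms by (intro that[of s]) auto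
  qed
  define S where "S = {s'..t} \<inter> f -` {..c}"
  have cont': "continuous_on {s'..t} f" using cont s' by (auto intro: continuous_on_subset)
  have "closed S"
    unfolding S_def by (intro continuous_closed_preimage cont') auto
  have S: "t \<in> S" "bdd_below S" using ft s' by (auto simp: S_def intro!: bdd_belowI[of _ s'])
  \<comment> \<open>The first point after \<open>s'\<close> at which \<open>f\<close> is at most
    \<open>c\<close>; by continuity \<open>f\<close> equals \<open>c\<close> there.\<close>
  define c0 where "c0 = Inf S"
  have "c0 \<in> S" unfolding c0_def using S \<open>closed S\<close> by (intro closed_contains_Inf) auto
  have below: "c < f y" if "s' \<le> y" "y < c0" for y
    using that cInf_lower[OF _ S(2), of y] \<open>c0 \<in> S\<close> by (fastforce simp: S_def c0_def)
  have "s' < c0" "c0 \<le> t" "f c0 \<le> c" using \<open>c0 \<in> S\<close> s' by (auto simp: S_def less_le)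
  have "f c0 = c"
  proof (rule ccontr)
    assume "f c0 \<noteq> c"
    obtain y where "s' \<le> y" "y \<le> c0" "f y = c"
      using IVT2'[of f c0 c s'] \<open>f c0 \<le> c\<close> s' \<open>s' < c0\<close> \<open>c0 \<le> t\<close> 
        continuous_on_subset[OF cont', of "{s'..c0}"]
      by auto
    with below[of y] \<open>f c0 \<noteq> c\<close> show False by (cases "y = c0") auto
  qed
  then obtain d where d: "d < c0" "\<And>y. d < y \<Longrightarrow> y < c0 \<Longrightarrow> f y < c"
    using left[of c0] s' \<open>s' < c0\<close> \<open>c0 \<le> t\<close> by (auto simp: eventually_at_left_field)
  obtain y where "max d s' < y" "y < c0"
    using dense[of "max d s'" c0] d \<open>s' < c0\<close> by auto
  with d(2)[of y] below[of y] show False by auto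
qed

section \<open>The fundamental solution\<close>

locale regular_sl =
  fixes a b :: real and p \<rho> :: "real \<Rightarrow> real"
  assumes ab: "a < b"
    and cont_p: "continuous_on {a..b} p" and p_pos: "\<And>r. r \<in> {a..b} \<Longrightarrow> 0 < p r"
    and cont_rho: "continuous_on {a..b} \<rho>" and rho_pos: "\<And>r. r \<in> {a..b} \<Longrightarrow> 0 < \<rho> r"
begin

text \<open>Picard iteration for the system U' = P / p, P' = - \<mu> \<rho> U with initial values 0
  and 1, sorted by powers of - \<mu>. Each power costs two integrations; the one that produces
  \<open>ucoef\<close> is written out so that the recursion runs through \<open>pcoef\<close>
  alone.\<close>

primrec pcoef :: "nat \<Rightarrow> real \<Rightarrow> real" where
  "pcoef 0 = (\<lambda>r. 1)"
| "pcoef (Suc n) = (\<lambda>r. integral {a..r} (\<lambda>s. \<rho> s * integral {a..s} (\<lambda>t. pcoef n t / p t)))"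

definition ucoef :: "nat \<Rightarrow> real \<Rightarrow> real" where
  "ucoef n r = integral {a..r} (\<lambda>t. pcoef n t / p t)"

definition U :: "real \<Rightarrow> real \<Rightarrow> real" where
  "U \<mu> r = (\<Sum>n. (- \<mu>) ^ n * ucoef n r)"

text \<open>The quasi-derivative p U'. It gets its own series because \<open>p\<close> is merely
  continuous in this locale, so that U' itself need not be differentiable.\<close>

definition P :: "real \<Rightarrow> real \<Rightarrow> real" where
  "P \<mu> r = (\<Sum>n. (- \<mu>) ^ n * pcoef n r)"

lemma p_nz: "r \<in> {a..b} \<Longrightarrow> p r \<noteq> 0"
  using p_pos[of r] by auto

lemma pcoef_Suc: "pcoef (Suc n) r = integral {a..r} (\<lambda>s. \<rho> s * ucoef n s)"
  by (simp add: ucoef_def)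

lemma cont_coef: "continuous_on {a..b} (pcoef n) \<and> continuous_on {a..b} (ucoef n)"
proof (induction n)
  case 0
  have "continuous_on {a..b} (ucoef 0)"
    unfolding ucoef_def[abs_def]
    by (intro indefinite_integral_continuous_1 integrable_continuous_real
        continuous_intros cont_p) (auto simp: p_nz)
  then show ?case by simp
next
  case (Suc n)
  have 1: "continuous_on {a..b} (pcoef (Suc n))"
    unfolding pcoef_Suc
    by (intro indefinite_integral_continuous_1 integrable_continuous_real
        continuous_intros cont_rho) (use Suc in auto)
  have "continuous_on {a..b} (ucoef (Suc n))"
    unfolding ucoef_def[abs_def]
    by (intro indefinite_integral_continuous_1 integrable_continuous_real
        continuous_intros cont_p 1) (auto simp: p_nz)
  with 1 show ?case by blast
qed

lemma ucoef_deriv: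
  assumes "r \<in> {a..b}"
  shows "(ucoef n has_real_derivative pcoef n r / p r) (at r within {a..b})"
  unfolding ucoef_def[abs_def]
  by (intro integral_has_real_derivative[where g = "\<lambda>t. pcoef n t / p t"] assms
      continuous_intros cont_p) (use cont_coef p_nz in auto)

lemma pcoef_deriv:
  assumes "r \<in> {a..b}"
  shows "(pcoef n has_real_derivative (case n of 0 \<Rightarrow> 0 | Suc k \<Rightarrow> \<rho> r * ucoef k r)) (at r within {a..b})"
proof (cases n)
  case (Suc k)
  have "pcoef n = (\<lambda>r. integral {a..r} (\<lambda>s. \<rho> s * ucoef k s))"
    using pcoef_Suc Suc by auto
  moreover have "((\<lambda>r. integral {a..r} (\<lambda>s. \<rho> s * ucoef k s)) has_real_derivative \<rho> r * ucoef k r)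
      (at r within {a..b})"
    by (intro integral_has_real_derivative assms continuous_intros cont_rho) (use cont_coef in auto)
  ultimately show ?thesis by (simp add: Suc)
qed simp

text \<open>The integration against \<rho> raises the power of \<open>r - a\<close> and yields the
  factor 1/(n+1), which builds up the factorial. In the integration against 1/p the gain is given
  away by estimating \<open>r - a\<close> by \<open>b - a\<close>; one factorial is enough for an
  entire series.\<close>

lemma coef_bounds:
  obtains C D where "0 \<le> C" "0 \<le> D"
    "\<And>n r. r \<in> {a..b} \<Longrightarrow> \<bar>pcoef n r\<bar> \<le> (D * (r - a)) ^ n / fact n"
    "\<And>n r. r \<in> {a..b} \<Longrightarrow> \<bar>ucoef n r\<bar> \<le> C * ((D * (r - a)) ^ n / fact n)"
proof -
  have "continuous_on {a..b} (\<lambda>r. 1 / p r)"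
    by (intro continuous_intros cont_p) (auto simp: p_nz)
  then obtain K1 where K10: "0 \<le> K1" and K1: "\<And>r. r \<in> {a..b} \<Longrightarrow> \<bar>1 / p r\<bar> \<le> K1"
    using continuous_on_Icc_abs_bound by blast
  obtain K2 where K2: "\<And>r. r \<in> {a..b} \<Longrightarrow> \<bar>\<rho> r\<bar> \<le> K2"
    using continuous_on_Icc_abs_bound[OF cont_rho] by blast
  have K: "0 \<le> K1" "0 \<le> K2" using K10 K2[of a] ab by auto
  \<comment> \<open>\<open>C\<close> is the cost of the integration against 1/p over the whole
    interval, and \<open>D\<close> below adds the bound of \<rho>.\<close>
  define C where "C = K1 * (b - a)"
  define D where "D = K2 * C"
  have CD: "0 \<le> C" "0 \<le> D" using K ab by (auto simp: C_def D_def)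
  have u: "\<bar>ucoef n r\<bar> \<le> C * ((D * (r - a)) ^ n / fact n)"
    if p: "\<And>r. r \<in> {a..b} \<Longrightarrow> \<bar>pcoef n r\<bar> \<le> (D * (r - a)) ^ n / fact n"
      and r: "r \<in> {a..b}" for n r
  proof -
    define c where "c = K1 * ((D * (r - a)) ^ n / fact n)"
    have "\<bar>ucoef n r - ucoef n a\<bar> \<le> c * r - c * a"
    proof (rule abs_deriv_le_imp_abs_diff_le[where a = a and b = r])
      show "(ucoef n has_real_derivative pcoef n x / p x) (at x within {a..r})"
        if "x \<in> {a..r}" for x
        by (rule has_field_derivative_subset[OF ucoef_deriv]) (use that r in auto)
      show "((*) c has_real_derivative c) (at x within {a..r})" if "x \<in> {a..r}" for x
        using DERIV_cmult_Id .
      show "\<bar>pcoef n x / p x\<bar> \<le> c" if "x \<in> {a..r}" for x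
      proof -
        have "\<bar>pcoef n x / p x\<bar> = \<bar>1 / p x\<bar> * \<bar>pcoef n x\<bar>" by (simp add: abs_mult)
        also have "\<dots> \<le> K1 * ((D * (x - a)) ^ n / fact n)"
          using that r K by (intro mult_mono K1 p) auto
        also have "\<dots> \<le> c" unfolding c_def
          using that r K CD by (intro mult_left_mono divide_right_mono power_mono) auto
        finally show ?thesis .
      qed
    qed (use r in auto)
    moreover have "ucoef n a = 0" by (simp add: ucoef_def)
    moreover have "c * r - c * a \<le> C * ((D * (r - a)) ^ n / fact n)"
    proof -
      have "c * (r - a) \<le> c * (b - a)"
        using r K CD by (intro mult_left_mono) (auto simp: c_def)
      moreover have "c * (b - a) = C * ((D * (r - a)) ^ n / fact n)"
        by (simp add: c_def C_def)
      ultimately show ?thesis by (simp add: right_diff_distrib)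
    qed
    ultimately show ?thesis by simp
  qed
  have pb: "\<bar>pcoef n r\<bar> \<le> (D * (r - a)) ^ n / fact n" if "r \<in> {a..b}" for n r
    using that
  proof (induction n arbitrary: r)
    case (Suc n)
    define G where "G = (\<lambda>x. (D * (x - a)) ^ Suc n / fact (Suc n))"
    have "\<bar>pcoef (Suc n) r - pcoef (Suc n) a\<bar> \<le> G r - G a"
    proof (rule abs_deriv_le_imp_abs_diff_le[where a = a and b = b])
      show "(pcoef (Suc n) has_real_derivative \<rho> x * ucoef n x) (at x within {a..b})"
        if "x \<in> {a..b}" for x
        using pcoef_deriv[OF that, of "Suc n"] by simp
      show "(G has_real_derivative D * ((D * (x - a)) ^ n / fact n)) (at x within {a..b})" for x
      proof -
        have "((\<lambda>x. D * (x - a)) has_real_derivative D) (at x within {a..b})"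
          by (auto intro!: derivative_eq_intros)
        from DERIV_cdivide[OF DERIV_power[OF this, of "Suc n"], of "fact (Suc n)"] show ?thesis
          unfolding G_def by (rule DERIV_cong) (simp add: fact_Suc del: of_nat_Suc)
      qed
      show "\<bar>\<rho> x * ucoef n x\<bar> \<le> D * ((D * (x - a)) ^ n / fact n)" if "x \<in> {a..b}" for x
      proof -
        have "\<bar>\<rho> x * ucoef n x\<bar> \<le> K2 * (C * ((D * (x - a)) ^ n / fact n))"
          unfolding abs_mult using that K by (intro mult_mono K2 u Suc.IH) auto
        then show ?thesis by (simp add: D_def mult.assoc)
      qed
    qed (use Suc.prems in auto)
    moreover have "pcoef (Suc n) a = 0" "G a = 0" by (simp_all add: G_def)
    ultimately show ?case by (simp add: G_def)
  qed simp
  show thesis using that[OF CD pb u[OF pb]] by blast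
qed

text \<open>Exponential series dominate both series at once. The majorant depends on \<mu> only
  through a bound \<open>M\<close>, which makes the convergence uniform on strips and not only for
  fixed \<mu>.\<close>

lemma coef_majorant:
  obtains C where "\<And>M n r \<mu>. r \<in> {a..b} \<Longrightarrow> \<bar>\<mu>\<bar> \<le> M \<Longrightarrow>
      \<bar>(- \<mu>) ^ n * pcoef n r\<bar> \<le> C M n \<and> \<bar>(- \<mu>) ^ n * ucoef n r\<bar> \<le> C M n"
    "\<And>M. summable (C M)"
proof -
  obtain C D where CD: "0 \<le> C" "0 \<le> D"
    "\<And>n r. r \<in> {a..b} \<Longrightarrow> \<bar>pcoef n r\<bar> \<le> (D * (r - a)) ^ n / fact n"
    "\<And>n r. r \<in> {a..b} \<Longrightarrow> \<bar>ucoef n r\<bar> \<le> C * ((D * (r - a)) ^ n / fact n)"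
    using coef_bounds by metis
  \<comment> \<open>In the factor \<open>1 + C\<close> the summand 1 serves \<open>pcoef\<close> and
    the summand \<open>C\<close> serves \<open>ucoef\<close>.\<close>
  define N where "N = (\<lambda>M n. (1 + C) * ((M * (D * (b - a))) ^ n / fact n))"
  have le: "M ^ n * ((D * (r - a)) ^ n / fact n) \<le> (M * (D * (b - a))) ^ n / fact n"
    if "r \<in> {a..b}" "0 \<le> M" for M r n
    unfolding power_mult_distrib[of M] times_divide_eq_right
    using that CD by (intro divide_right_mono mult_left_mono power_mono) auto
  have nn: "0 \<le> (M * (D * (b - a))) ^ n / fact n" if "0 \<le> M" for M n
    using that CD ab by simp
  show thesis
  proof
    fix M r \<mu> :: real and n assume r: "r \<in> {a..b}" and \<mu>: "\<bar>\<mu>\<bar> \<le> M"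
    then have M: "0 \<le> M" by simp
    have Mn: "\<bar>(- \<mu>) ^ n\<bar> \<le> M ^ n" using power_mono[OF \<mu>, of n] by (simp add: power_abs)
    have "\<bar>(- \<mu>) ^ n * pcoef n r\<bar> \<le> M ^ n * ((D * (r - a)) ^ n / fact n)"
      unfolding abs_mult by (intro mult_mono Mn CD r) (use M in auto)
    also have "\<dots> \<le> N M n"
      unfolding N_def using le[OF r M, of n] mult_nonneg_nonneg[OF CD(1) nn[OF M, of n]]
      by (simp only: distrib_right)
    finally have 1: "\<bar>(- \<mu>) ^ n * pcoef n r\<bar> \<le> N M n" .
    have "\<bar>(- \<mu>) ^ n * ucoef n r\<bar> \<le> M ^ n * (C * ((D * (r - a)) ^ n / fact n))"
      unfolding abs_mult by (intro mult_mono Mn CD r) (use M in auto)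
    also have "\<dots> = C * (M ^ n * ((D * (r - a)) ^ n / fact n))" by simp
    also have "\<dots> \<le> C * ((M * (D * (b - a))) ^ n / fact n)"
      by (rule mult_left_mono[OF le[OF r M] CD(1)])
    also have "\<dots> \<le> N M n"
      unfolding N_def using nn[OF M, of n] by (intro mult_right_mono) auto
    finally show "\<bar>(- \<mu>) ^ n * pcoef n r\<bar> \<le> N M n \<and> \<bar>(- \<mu>) ^ n * ucoef n r\<bar> \<le> N M n"
      using 1 by blast
  next
    show "summable (N M)" for M
      unfolding N_def using summable_exp[of "M * (D * (b - a))"]
      by (intro summable_mult) (simp add: field_simps)
  qed
qed

lemma summable_coef:
  assumes "r \<in> {a..b}"
  shows "summable (\<lambda>n. (- \<mu>) ^ n * ucoef n r)" "summable (\<lambda>n. (- \<mu>) ^ n * pcoef n r)"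
proof -
  obtain C where C: "\<And>M n r \<mu>. r \<in> {a..b} \<Longrightarrow> \<bar>\<mu>\<bar> \<le> M \<Longrightarrow>
      \<bar>(- \<mu>) ^ n * pcoef n r\<bar> \<le> C M n \<and> \<bar>(- \<mu>) ^ n * ucoef n r\<bar> \<le> C M n"
    "\<And>M. summable (C M)" using coef_majorant by metis
  show "summable (\<lambda>n. (- \<mu>) ^ n * ucoef n r)" "summable (\<lambda>n. (- \<mu>) ^ n * pcoef n r)"
    using C(1)[OF assms order_refl, of \<mu>]
    by (auto intro!: summable_comparison_test'[OF C(2)[of "\<bar>\<mu>\<bar>"]])
qed

text \<open>The Weierstrass test gives uniform convergence only for bounded \<mu>, hence continuity
  on each open strip; continuity being local, the strips exhaust the whole range of \<mu>.\<close>

lemma continuous_UP: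
  "continuous_on (UNIV \<times> {a..b}) (\<lambda>z. U (fst z) (snd z))"
  "continuous_on (UNIV \<times> {a..b}) (\<lambda>z. P (fst z) (snd z))"
proof -
  obtain C where C: "\<And>M n r \<mu>. r \<in> {a..b} \<Longrightarrow> \<bar>\<mu>\<bar> \<le> M \<Longrightarrow>
      \<bar>(- \<mu>) ^ n * pcoef n r\<bar> \<le> C M n \<and> \<bar>(- \<mu>) ^ n * ucoef n r\<bar> \<le> C M n"
    "\<And>M. summable (C M)" using coef_majorant by metis
  have coef: "continuous_on (UNIV \<times> {a..b}) (\<lambda>z::real\<times>real. f (snd z))"
    if "continuous_on {a..b} f" for f :: "real \<Rightarrow> real"
    by (rule continuous_on_compose2[OF that]) (auto intro: continuous_intros)
  have *: "continuous_on (UNIV \<times> {a..b}) (\<lambda>z. \<Sum>n. (- fst z) ^ n * f n (snd z))"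
    if f: "\<And>n. continuous_on {a..b} (f n)"
      and le: "\<And>M n r \<mu>. r \<in> {a..b} \<Longrightarrow> \<bar>\<mu>\<bar> \<le> M \<Longrightarrow> \<bar>(- \<mu>) ^ n * f n r\<bar> \<le> C M n"
    for f :: "nat \<Rightarrow> real \<Rightarrow> real"
  proof -
    have part: "continuous_on ({- M<..<M} \<times> {a..b}) (\<lambda>z. \<Sum>n. (- fst z) ^ n * f n (snd z))" for M
    proof (rule uniform_limit_theorem[OF _ Weierstrass_m_test])
      show "\<forall>\<^sub>F n in sequentially. continuous_on ({- M<..<M} \<times> {a..b})
          (\<lambda>x. \<Sum>i<n. (- fst x) ^ i * f i (snd x))"
        by (intro always_eventually allI continuous_intros continuous_on_subset[OF coef[OF f]]) auto
      show "norm ((- fst z) ^ n * f n (snd z)) \<le> C M n" if "z \<in> {- M<..<M} \<times> {a..b}" for n z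
        using that by (auto intro!: le)
    qed (use C(2) in auto)
    show ?thesis
      unfolding continuous_on_eq_continuous_within
    proof
      fix z :: "real \<times> real" assume z: "z \<in> UNIV \<times> {a..b}"
      \<comment> \<open>The extra 1 puts \<open>z\<close> into the interior of the strip with
        respect to \<mu>, so that strip and full domain have the same punctured neighbourhoods at
        \<open>z\<close>.\<close>
      define M where "M = \<bar>fst z\<bar> + 1"
      have "z \<in> {- M<..<M} \<times> {a..b}" using z by (auto simp: M_def mem_Times_iff)
      then have "continuous (at z within ({- M<..<M} \<times> {a..b})) (\<lambda>z. \<Sum>n. (- fst z) ^ n * f n (snd z))"
        using part[of M] by (auto simp: continuous_on_eq_continuous_within)
      moreover have "at z within ({- M<..<M} \<times> {a..b}) = at z within (UNIV \<times> {a..b})"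
        by (rule at_within_nhd[of _ "{- M<..<M} \<times> UNIV"])
          (use z in \<open>auto simp: M_def mem_Times_iff intro!: open_Times\<close>)
      ultimately show "continuous (at z within (UNIV \<times> {a..b})) (\<lambda>z. \<Sum>n. (- fst z) ^ n * f n (snd z))"
        by simp
    qed
  qed
  show "continuous_on (UNIV \<times> {a..b}) (\<lambda>z. U (fst z) (snd z))"
    "continuous_on (UNIV \<times> {a..b}) (\<lambda>z. P (fst z) (snd z))"
    unfolding U_def P_def using C(1) cont_coef by (auto intro!: *)
qed

lemma U_deriv:
  assumes "r \<in> {a..b}"
  shows "(U \<mu> has_real_derivative P \<mu> r / p r) (at r within {a..b})"
proof -
  obtain C where C: "\<And>M n r \<mu>. r \<in> {a..b} \<Longrightarrow> \<bar>\<mu>\<bar> \<le> M \<Longrightarrow>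
      \<bar>(- \<mu>) ^ n * pcoef n r\<bar> \<le> C M n \<and> \<bar>(- \<mu>) ^ n * ucoef n r\<bar> \<le> C M n"
    "\<And>M. summable (C M)" using coef_majorant by metis
  have "continuous_on {a..b} (\<lambda>r. 1 / p r)"
    by (intro continuous_intros cont_p) (auto simp: p_nz)
  then obtain K1 where K10: "0 \<le> K1" and K1: "\<And>r. r \<in> {a..b} \<Longrightarrow> \<bar>1 / p r\<bar> \<le> K1"
    using continuous_on_Icc_abs_bound by blast
  have "\<exists>g. \<forall>x\<in>{a..b}. (\<lambda>n. (- \<mu>) ^ n * ucoef n x) sums g x \<and>
      (g has_field_derivative (\<Sum>n. (- \<mu>) ^ n * (pcoef n x / p x))) (at x within {a..b})"
  proof (rule has_field_derivative_series)
    show "((\<lambda>x. (- \<mu>) ^ n * ucoef n x) has_real_derivative (- \<mu>) ^ n * (pcoef n x / p x))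
        (at x within {a..b})" if "x \<in> {a..b}" for n x
      using that by (intro DERIV_cmult ucoef_deriv)
    show "uniform_limit {a..b} (\<lambda>n x. \<Sum>i<n. (- \<mu>) ^ i * (pcoef i x / p x))
        (\<lambda>x. \<Sum>n. (- \<mu>) ^ n * (pcoef n x / p x)) sequentially"
    proof (rule Weierstrass_m_test)
      show "norm ((- \<mu>) ^ n * (pcoef n x / p x)) \<le> K1 * C \<bar>\<mu>\<bar> n" if "x \<in> {a..b}" for n x
      proof -
        have "norm ((- \<mu>) ^ n * (pcoef n x / p x)) = \<bar>1 / p x\<bar> * \<bar>(- \<mu>) ^ n * pcoef n x\<bar>"
          by (simp add: abs_mult)
        also have "\<dots> \<le> K1 * C \<bar>\<mu>\<bar> n"
          using C(1)[OF that order_refl, of \<mu> n] K1[OF that] K10 by (intro mult_mono) auto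
        finally show ?thesis .
      qed
    qed (intro summable_mult C)
    show "a \<in> {a..b}" using ab by simp
    show "summable (\<lambda>n. (- \<mu>) ^ n * ucoef n a)" using summable_coef ab by auto
  qed simp
  then obtain g where g: "\<And>x. x \<in> {a..b} \<Longrightarrow> (\<lambda>n. (- \<mu>) ^ n * ucoef n x) sums g x"
    "\<And>x. x \<in> {a..b} \<Longrightarrow> (g has_field_derivative (\<Sum>n. (- \<mu>) ^ n * (pcoef n x / p x))) (at x within {a..b})"
    by blast
  have U: "U \<mu> x = g x" if "x \<in> {a..b}" for x
    using g(1)[OF that] by (simp add: U_def sums_iff)
  have P: "(\<Sum>n. (- \<mu>) ^ n * (pcoef n r / p r)) = P \<mu> r / p r"
    unfolding P_def using suminf_divide[OF summable_coef(2)[OF assms], of \<mu> "p r"] by simp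
  have "(U \<mu> has_real_derivative (\<Sum>n. (- \<mu>) ^ n * (pcoef n r / p r))) (at r within {a..b})"
    by (rule has_field_derivative_transform_within[OF g(2)[OF assms] zero_less_one assms]) (simp add: U)
  then show ?thesis by (simp only: P)
qed

lemma P_deriv:
  assumes "r \<in> {a..b}"
  shows "(P \<mu> has_real_derivative - \<mu> * \<rho> r * U \<mu> r) (at r within {a..b})"
proof -
  define d where "d = (\<lambda>n x. (- \<mu>) ^ n * (case n of 0 \<Rightarrow> 0 | Suc k \<Rightarrow> \<rho> x * ucoef k x))"
  obtain C where C: "\<And>M n r \<mu>. r \<in> {a..b} \<Longrightarrow> \<bar>\<mu>\<bar> \<le> M \<Longrightarrow>
      \<bar>(- \<mu>) ^ n * pcoef n r\<bar> \<le> C M n \<and> \<bar>(- \<mu>) ^ n * ucoef n r\<bar> \<le> C M n"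
    "\<And>M. summable (C M)" using coef_majorant by metis
  obtain K2 where K2: "\<And>r. r \<in> {a..b} \<Longrightarrow> \<bar>\<rho> r\<bar> \<le> K2"
    using continuous_on_Icc_abs_bound[OF cont_rho] by blast
  have dS: "d (Suc n) x = - \<mu> * \<rho> x * ((- \<mu>) ^ n * ucoef n x)" for n x
    by (simp add: d_def)
  have "\<exists>g. \<forall>x\<in>{a..b}. (\<lambda>n. (- \<mu>) ^ n * pcoef n x) sums g x \<and>
      (g has_field_derivative (\<Sum>n. d n x)) (at x within {a..b})"
  proof (rule has_field_derivative_series)
    show "((\<lambda>x. (- \<mu>) ^ n * pcoef n x) has_real_derivative d n x)
        (at x within {a..b})" if "x \<in> {a..b}" for n x
      unfolding d_def using that by (intro DERIV_cmult pcoef_deriv)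
    define E where "E = (\<lambda>n. case n of 0 \<Rightarrow> 0 | Suc k \<Rightarrow> \<bar>\<mu>\<bar> * K2 * C \<bar>\<mu>\<bar> k)"
    show "uniform_limit {a..b} (\<lambda>n x. \<Sum>i<n. d i x) (\<lambda>x. \<Sum>n. d n x) sequentially"
    proof (rule Weierstrass_m_test)
      show "norm (d n x) \<le> E n" if x: "x \<in> {a..b}" for n x
      proof (cases n)
        case (Suc k)
        have "norm (d n x) = \<bar>\<mu>\<bar> * \<bar>\<rho> x\<bar> * \<bar>(- \<mu>) ^ k * ucoef k x\<bar>"
          by (simp add: dS Suc abs_mult)
        also have "\<dots> \<le> \<bar>\<mu>\<bar> * K2 * C \<bar>\<mu>\<bar> k"
          using C(1)[OF x order_refl, of \<mu> k] K2[OF x] by (intro mult_mono) auto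
        finally show ?thesis by (simp add: E_def Suc)
      qed (simp add: E_def d_def)
      have "summable (\<lambda>n. E (Suc n))" unfolding E_def by (simp add: summable_mult C)
      then show "summable E" by (simp add: summable_Suc_iff)
    qed
    show "a \<in> {a..b}" using ab by simp
    show "summable (\<lambda>n. (- \<mu>) ^ n * pcoef n a)" using summable_coef ab by auto
  qed simp
  then obtain g where g: "\<And>x. x \<in> {a..b} \<Longrightarrow> (\<lambda>n. (- \<mu>) ^ n * pcoef n x) sums g x"
    "\<And>x. x \<in> {a..b} \<Longrightarrow> (g has_field_derivative (\<Sum>n. d n x)) (at x within {a..b})"
    by blast
  have P: "P \<mu> x = g x" if "x \<in> {a..b}" for x
    using g(1)[OF that] by (simp add: P_def sums_iff)
  \<comment> \<open>The derivative of the constant coefficient vanishes, and after a shift of the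
    index by one the remaining terms are those of \<open>U\<close> times - \<mu> \<rho>.\<close>
  have "(\<lambda>n. d (Suc n) r) sums (- \<mu> * \<rho> r * U \<mu> r)"
    unfolding dS U_def using summable_coef(1)[OF assms] by (intro sums_mult summable_sums)
  then have "(\<lambda>n. d n r) sums (- \<mu> * \<rho> r * U \<mu> r + d 0 r)"
    by (rule sums_Suc)
  moreover have "d 0 r = 0" by (simp add: d_def)
  ultimately have "(\<Sum>n. d n r) = - \<mu> * \<rho> r * U \<mu> r"
    using sums_unique by fastforce
  moreover have "(P \<mu> has_real_derivative (\<Sum>n. d n r)) (at r within {a..b})"
    by (rule has_field_derivative_transform_within[OF g(2)[OF assms] zero_less_one assms]) (simp add: P)
  ultimately show ?thesis by simp
qed

lemma U_left: "U \<mu> a = 0"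
  by (simp add: U_def ucoef_def)

lemma P_left: "P \<mu> a = 1"
proof -
  have "pcoef n a = (if n = 0 then 1 else 0)" for n by (cases n) auto
  then have "(\<lambda>n. (- \<mu>) ^ n * pcoef n a) = (\<lambda>n. if n = 0 then 1 else 0)"
    by (auto simp: fun_eq_iff)
  then show ?thesis using sums_single[of 0 "\<lambda>_. 1::real"] by (simp add: P_def sums_iff)
qed

section \<open>Uniqueness for the initial value problem and the eigenvalue condition\<close>

lemma cont_inv_p: "continuous_on {a..b} (\<lambda>r. 1 / p r)"
  by (intro continuous_intros cont_p) (auto simp: p_nz)

lemma cont_U: "continuous_on {a..b} (U \<mu>)"
  by (rule DERIV_continuous_on[OF U_deriv])

text \<open>The energy \<open>f r \<bullet> f r + Y r \<bullet> Y r\<close> has derivative (1/p -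
  \<mu> \<rho>) times 2 \<open>f r \<bullet> Y r\<close>, hence grows at most exponentially from 0.
  An inner product space as range lets this act on complex-valued eigenfunctions directly.\<close>

lemma solution_zero:
  fixes f Y :: "real \<Rightarrow> 'e :: real_inner"
  assumes f: "\<And>r. r \<in> {a..b} \<Longrightarrow> (f has_vector_derivative (1 / p r) *\<^sub>R Y r) (at r within {a..b})"
    and Y: "\<And>r. r \<in> {a..b} \<Longrightarrow> (Y has_vector_derivative - (\<mu> * \<rho> r) *\<^sub>R f r) (at r within {a..b})"
    and "f a = 0" "Y a = 0" and r: "r \<in> {a..b}"
  shows "f r = 0"
proof -
  define e where "e = (\<lambda>r. f r \<bullet> f r + Y r \<bullet> Y r)"
  obtain K where K0: "0 \<le> K" and K: "\<And>r. r \<in> {a..b} \<Longrightarrow> \<bar>1 / p r - \<mu> * \<rho> r\<bar> \<le> K"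
    using continuous_on_Icc_abs_bound[OF continuous_on_diff[OF cont_inv_p
          continuous_on_mult_left[OF cont_rho, of \<mu>]]] by blast
  have "e r \<le> e a * exp (K * (r - a))"
  proof (rule gronwall_upper[where e' = "\<lambda>r. (1 / p r - \<mu> * \<rho> r) * (2 * (f r \<bullet> Y r))", OF _ _ r])
    fix r assume r: "r \<in> {a..b}"
    show "(e has_real_derivative (1 / p r - \<mu> * \<rho> r) * (2 * (f r \<bullet> Y r))) (at r within {a..b})"
      unfolding e_def has_real_derivative_iff_has_vector_derivative
      by (rule has_vector_derivative_eq_rhs[OF has_vector_derivative_add[OF
            bounded_bilinear.has_vector_derivative[OF bounded_bilinear_inner f[OF r] f[OF r]]
            bounded_bilinear.has_vector_derivative[OF bounded_bilinear_inner Y[OF r] Y[OF r]]]])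
        (simp add: inner_commute algebra_simps)
    have "\<bar>2 * (f r \<bullet> Y r)\<bar> \<le> e r"
    proof -
      have "0 \<le> (f r - Y r) \<bullet> (f r - Y r)" "0 \<le> (f r + Y r) \<bullet> (f r + Y r)" by auto
      then show ?thesis
        by (simp add: e_def inner_diff_left inner_diff_right inner_add_left inner_add_right
            inner_commute abs_le_iff)
    qed
    then have "\<bar>(1 / p r - \<mu> * \<rho> r) * (2 * (f r \<bullet> Y r))\<bar> \<le> K * e r"
      unfolding abs_mult[of "1 / p r - \<mu> * \<rho> r"] by (intro mult_mono K r K0) auto
    then show "(1 / p r - \<mu> * \<rho> r) * (2 * (f r \<bullet> Y r)) \<le> K * e r" by linarith
  qed
  also have "e a = 0" by (simp add: e_def assms)
  finally have "e r \<le> 0" by simp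
  moreover have "0 \<le> f r \<bullet> f r" "0 \<le> Y r \<bullet> Y r" by auto
  ultimately have "f r \<bullet> f r = 0" unfolding e_def by linarith
  then show ?thesis by simp
qed

text \<open>Subtracting from \<open>f\<close> the multiple of \<open>U\<close> with the same
  quasi-derivative at \<open>a\<close> leaves a solution with zero initial data. The complex factor
  carries the whole freedom of an eigenfunction; this is the simplicity of the eigenvalues.\<close>

lemma eigenfunction_eq:
  assumes "sl_eigenfunction p \<rho> a b \<mu> f"
  obtains c where "c \<noteq> 0" "\<And>r. r \<in> {a..b} \<Longrightarrow> f r = c * complex_of_real (U \<mu> r)" "U \<mu> b = 0"
proof -
  obtain f' where f': "\<And>r. r \<in> {a..b} \<Longrightarrow> (f has_vector_derivative f' r) (at r within {a..b})"
    "\<And>r. r \<in> {a..b} \<Longrightarrow>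
      ((\<lambda>s. p s *\<^sub>R f' s) has_vector_derivative - (\<mu> * \<rho> r) *\<^sub>R f r) (at r within {a..b})"
    and fa: "f a = 0" "f b = 0" and nz: "\<exists>r\<in>{a..b}. f r \<noteq> 0"
    using assms unfolding sl_eigenfunction_def sl_solution_def by blast
  define c where "c = p a *\<^sub>R f' a"
  have eq: "f r = c * complex_of_real (U \<mu> r)" if r: "r \<in> {a..b}" for r
  proof -
    have "f r - c * complex_of_real (U \<mu> r) = 0"
    proof (rule solution_zero[OF _ _ _ _ r,
          where f = "\<lambda>r. f r - c * complex_of_real (U \<mu> r)"
            and Y = "\<lambda>r. p r *\<^sub>R f' r - c * complex_of_real (P \<mu> r)" and \<mu> = \<mu>])
      fix r assume r: "r \<in> {a..b}"
      have U': "((\<lambda>r. c * complex_of_real (U \<mu> r)) has_vector_derivative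
          c * complex_of_real (P \<mu> r / p r)) (at r within {a..b})"
        by (intro has_vector_derivative_mult_right has_vector_derivative_of_real U_deriv r)
      have P': "((\<lambda>r. c * complex_of_real (P \<mu> r)) has_vector_derivative
          c * complex_of_real (- \<mu> * \<rho> r * U \<mu> r)) (at r within {a..b})"
        by (intro has_vector_derivative_mult_right has_vector_derivative_of_real P_deriv r)
      show "((\<lambda>r. f r - c * complex_of_real (U \<mu> r)) has_vector_derivative
          (1 / p r) *\<^sub>R (p r *\<^sub>R f' r - c * complex_of_real (P \<mu> r))) (at r within {a..b})"
        by (rule has_vector_derivative_eq_rhs[OF has_vector_derivative_diff[OF f'(1)[OF r] U']])
          (use p_nz[OF r] in \<open>simp add: scaleR_conv_of_real field_simps\<close>)
      show "((\<lambda>r. p r *\<^sub>R f' r - c * complex_of_real (P \<mu> r)) has_vector_derivative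
          - (\<mu> * \<rho> r) *\<^sub>R (f r - c * complex_of_real (U \<mu> r))) (at r within {a..b})"
        by (rule has_vector_derivative_eq_rhs[OF has_vector_derivative_diff[OF f'(2)[OF r] P']])
          (simp add: scaleR_conv_of_real algebra_simps)
    qed (simp_all add: fa U_left P_left c_def)
    then show ?thesis by simp
  qed
  have "c \<noteq> 0" using nz eq by auto
  moreover have "U \<mu> b = 0" using eq[of b] fa ab \<open>c \<noteq> 0\<close> by auto
  ultimately show thesis using that eq by blast
qed

text \<open>The one-sided derivative of \<open>U\<close> at \<open>a\<close> is 1 / p(a), which is
  not 0.\<close>

lemma U_not_all_zero: "\<exists>r\<in>{a..b}. U \<mu> r \<noteq> 0"
proof (rule ccontr)
  assume z: "\<not> ?thesis"
  have a: "a \<in> {a..b}" using ab by simp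
  have "(U \<mu> has_vector_derivative P \<mu> a / p a) (at a within {a..b})"
    using U_deriv[OF a] by (simp add: has_real_derivative_iff_has_vector_derivative)
  moreover have "(U \<mu> has_vector_derivative 0) (at a within {a..b})"
    by (rule has_vector_derivative_transform[OF a _ has_vector_derivative_const]) (use z in auto)
  ultimately have "P \<mu> a / p a = 0"
    using vector_derivative_unique_within_closed_interval[of a b a "U \<mu>" "P \<mu> a / p a" 0] ab
    by (simp only: cbox_interval a)
  then show False using p_nz[OF a] by (simp add: P_left)
qed

lemma eigenvalueI:
  assumes "U \<mu> b = 0"
  shows "sl_eigenvalue p \<rho> a b \<mu>"
  unfolding sl_eigenvalue_def sl_eigenfunction_def sl_solution_def
proof (intro exI conjI ballI)
  fix r assume r: "r \<in> {a..b}"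
  show "((\<lambda>r. complex_of_real (U \<mu> r)) has_vector_derivative complex_of_real (P \<mu> r / p r))
      (at r within {a..b})"
    by (intro has_vector_derivative_of_real U_deriv r)
  have "((\<lambda>s. complex_of_real (P \<mu> s)) has_vector_derivative complex_of_real (- \<mu> * \<rho> r * U \<mu> r))
      (at r within {a..b})"
    by (intro has_vector_derivative_of_real P_deriv r)
  then have "((\<lambda>s. p s *\<^sub>R complex_of_real (P \<mu> s / p s)) has_vector_derivative
      complex_of_real (- \<mu> * \<rho> r * U \<mu> r)) (at r within {a..b})"
    by (rule has_vector_derivative_transform[OF r, rotated])
      (use p_nz in \<open>auto simp: scaleR_conv_of_real\<close>)
  then show "((\<lambda>s. p s *\<^sub>R complex_of_real (P \<mu> s / p s)) has_vector_derivative
      - (\<mu> * \<rho> r) *\<^sub>R complex_of_real (U \<mu> r)) (at r within {a..b})"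
    by (simp add: scaleR_conv_of_real)
qed (use assms U_not_all_zero in \<open>auto simp: U_left\<close>)

text \<open>The left side is the value at \<open>b\<close> of a Wronskian that vanishes at
  \<open>a\<close> and whose derivative is the integrand times \<mu> - \<nu>. It compares solutions
  for two spectral parameters without a derivative in \<mu>.\<close>

lemma lagrange_identity:
  "U \<mu> b * P \<nu> b - P \<mu> b * U \<nu> b
    = (\<mu> - \<nu>) * integral {a..b} (\<lambda>r. \<rho> r * U \<mu> r * U \<nu> r)"
proof -
  define W where "W = (\<lambda>r. U \<mu> r * P \<nu> r - P \<mu> r * U \<nu> r)"
  have "((\<lambda>r. (\<mu> - \<nu>) * (\<rho> r * U \<mu> r * U \<nu> r)) has_integral W b - W a) {a..b}"
  proof (rule fundamental_theorem_of_calculus)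
    fix r assume r: "r \<in> {a..b}"
    have "(W has_real_derivative (\<mu> - \<nu>) * (\<rho> r * U \<mu> r * U \<nu> r)) (at r within {a..b})"
      unfolding W_def
      by (rule derivative_eq_intros refl U_deriv P_deriv r)+ (simp add: algebra_simps)
    then show "(W has_vector_derivative (\<mu> - \<nu>) * (\<rho> r * U \<mu> r * U \<nu> r)) (at r within {a..b})"
      by (simp add: has_real_derivative_iff_has_vector_derivative)
  qed (use ab in simp)
  then have "integral {a..b} (\<lambda>r. (\<mu> - \<nu>) * (\<rho> r * U \<mu> r * U \<nu> r)) = W b - W a"
    by (rule integral_unique)
  then show ?thesis by (simp add: W_def U_left)
qed

lemma norm_U_pos: "0 < integral {a..b} (\<lambda>r. \<rho> r * U \<mu> r * U \<mu> r)"
proof -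
  have c: "continuous_on {a..b} (\<lambda>r. \<rho> r * U \<mu> r * U \<mu> r)"
    by (intro continuous_intros cont_rho cont_U)
  have nn: "0 \<le> \<rho> r * U \<mu> r * U \<mu> r" if "r \<in> {a..b}" for r
    using rho_pos[OF that] by (simp add: mult.assoc)
  have "integral {a..b} (\<lambda>r. \<rho> r * U \<mu> r * U \<mu> r) \<noteq> 0"
    using integral_eq_0_iff[OF c ab nn] U_not_all_zero[of \<mu>] rho_pos by force
  moreover have "0 \<le> integral {a..b} (\<lambda>r. \<rho> r * U \<mu> r * U \<mu> r)"
    by (intro integral_nonneg integrable_continuous_real c nn)
  ultimately show ?thesis by linarith
qed

text \<open>At a zero of \<open>U \<nu>\<close> only one term of the Lagrange identity survives, and
  the integral \<open>J\<close> in it is positive for \<mu> near \<nu>: it is continuous and at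
  \<nu> equals a squared norm. So \<open>U \<mu> b\<close> changes sign at an eigenvalue, in the
  direction given by \<open>P \<nu> b\<close>.\<close>

lemma wronskian_sign:
  assumes "U \<nu> b = 0"
  shows "eventually (\<lambda>\<mu>. sgn (U \<mu> b * P \<nu> b) = sgn (\<mu> - \<nu>)) (nhds \<nu>)"
proof -
  define J where "J = (\<lambda>\<mu>. integral (cbox a b) (\<lambda>r. \<rho> r * U \<mu> r * U \<nu> r))"
  have "continuous_on UNIV J"
    unfolding J_def
  proof (rule integral_continuous_on_param)
    have "continuous_on (UNIV \<times> {a..b}) (\<lambda>z. \<rho> (snd z) * U (fst z) (snd z) * U \<nu> (snd z))"
      by (intro continuous_intros continuous_UP(1) continuous_on_compose2[OF cont_rho]
          continuous_on_compose2[OF cont_U]) auto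
    then show "continuous_on (UNIV \<times> cbox a b) (\<lambda>(\<mu>, r). \<rho> r * U \<mu> r * U \<nu> r)"
      by (simp add: case_prod_beta)
  qed
  moreover have "0 < J \<nu>" using norm_U_pos[of \<nu>] by (simp add: J_def)
  ultimately have "eventually (\<lambda>\<mu>. 0 < J \<mu>) (nhds \<nu>)"
    by (auto simp: continuous_on_eq_continuous_at continuous_at tendsto_at_iff_tendsto_nhds
        intro: order_tendstoD)
  then show ?thesis
  proof eventually_elim
    case (elim \<mu>)
    have "U \<mu> b * P \<nu> b = (\<mu> - \<nu>) * J \<mu>"
      using lagrange_identity[of \<mu> \<nu>] assms by (simp add: J_def)
    then show ?case using elim by (simp add: sgn_mult)
  qed
qed

text \<open>For \<mu> in (0, 1) the quasi-derivative \<open>P\<close> starts at 1 and moves by at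
  most \<mu> D, so it stays positive while \<mu> D < 1, and \<open>U\<close> then increases from
  0.\<close>

lemma U_pos_of_small:
  "\<exists>\<delta>>0. \<forall>\<mu>\<in>{0<..<\<delta>}. \<forall>r\<in>{a<..b}. 0 < U \<mu> r"
proof -
  have "compact ((\<lambda>z. U (fst z) (snd z)) ` ({0..1} \<times> {a..b}))"
    by (intro compact_continuous_image compact_Times compact_Icc
        continuous_on_subset[OF continuous_UP(1)]) auto
  then have "bounded ((\<lambda>z. U (fst z) (snd z)) ` ({0..1} \<times> {a..b}))"
    by (rule compact_imp_bounded)
  then obtain M where "\<forall>x\<in>(\<lambda>z. U (fst z) (snd z)) ` ({0..1} \<times> {a..b}). \<bar>x\<bar> \<le> M"
    by (auto simp: bounded_iff)
  then have M: "\<bar>U \<mu> r\<bar> \<le> M" if "\<mu> \<in> {0..1}" "r \<in> {a..b}" for \<mu> r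
    using that by fastforce
  obtain K where K0: "0 \<le> K" and K: "\<And>r. r \<in> {a..b} \<Longrightarrow> \<bar>\<rho> r\<bar> \<le> K"
    using continuous_on_Icc_abs_bound[OF cont_rho] by blast
  have M0: "0 \<le> M" using M[of 0 a] ab by auto
  define D where "D = K * M * (b - a)"
  have D: "0 \<le> D" using K0 M0 ab by (simp add: D_def)
  have P: "0 < P \<mu> r" if \<mu>: "0 < \<mu>" "\<mu> < 1" "\<mu> * D < 1" and r: "r \<in> {a..b}" for \<mu> r
  proof -
    have "\<bar>P \<mu> r - P \<mu> a\<bar> \<le> \<mu> * (K * M) * r - \<mu> * (K * M) * a"
    proof (rule abs_deriv_le_imp_abs_diff_le[where a = a and b = b])
      fix x assume x: "x \<in> {a..b}"
      show "(P \<mu> has_real_derivative - \<mu> * \<rho> x * U \<mu> x) (at x within {a..b})"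
        by (rule P_deriv[OF x])
      show "((*) (\<mu> * (K * M)) has_real_derivative \<mu> * (K * M)) (at x within {a..b})"
        by (rule DERIV_cmult_Id)
      show "\<bar>- \<mu> * \<rho> x * U \<mu> x\<bar> \<le> \<mu> * (K * M)"
        using K[OF x] M[of \<mu> x] \<mu> x K0 by (auto simp: abs_mult mult.assoc intro!: mult_mono)
    qed (use r in auto)
    also have "\<dots> = \<mu> * (K * M * (r - a))" by (simp add: algebra_simps)
    also have "\<dots> \<le> \<mu> * D"
      unfolding D_def using \<mu> r K0 M0 by (intro mult_left_mono) auto
    finally show ?thesis using \<mu> by (simp add: P_left)
  qed
  have U: "0 < U \<mu> r" if \<mu>: "0 < \<mu>" "\<mu> < 1" "\<mu> * D < 1" and r: "r \<in> {a<..b}" for \<mu> r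
  proof -
    have "U \<mu> a < U \<mu> r"
    proof (rule DERIV_pos_imp_increasing_open[where f = "U \<mu>"])
      show "continuous_on {a..r} (U \<mu>)" by (rule continuous_on_subset[OF cont_U]) (use r in auto)
      fix x assume x: "a < x" "x < r"
      then have "(U \<mu> has_real_derivative P \<mu> x / p x) (at x)"
        using U_deriv[of x \<mu>] r at_within_Icc_at[of a x b] by auto
      moreover have "0 < P \<mu> x / p x" using P[OF \<mu>, of x] p_pos[of x] x r by auto
      ultimately show "\<exists>y. (U \<mu> has_real_derivative y) (at x) \<and> 0 < y" by blast
    qed (use r in auto)
    then show ?thesis by (simp add: U_left)
  qed
  \<comment> \<open>The 1 keeps \<mu> in the range where \<open>M\<close> bounds \<open>U\<close>;
    \<open>D + 1\<close> instead of \<open>D\<close> avoids a zero denominator.\<close>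
  define \<delta> where "\<delta> = min 1 (1 / (D + 1))"
  have "0 < \<delta>" using D by (simp add: \<delta>_def)
  moreover have "\<mu> < 1 \<and> \<mu> * D < 1" if "\<mu> \<in> {0<..<\<delta>}" for \<mu>
  proof -
    have "\<mu> * (D + 1) < 1" using that D by (simp add: \<delta>_def less_divide_eq)
    moreover have "0 \<le> \<mu> * D" using that D by simp
    ultimately show ?thesis using that by (simp add: distrib_left)
  qed
  ultimately show ?thesis using U by (intro exI[of _ \<delta>]) auto
qed

end

section \<open>Liouville substitution and Pruefer angle\<close>

text \<open>Turning the unit vector (x, y) / s back by the angle \<theta> gives a vector whose two
  components have derivative 0, so it stays at its initial value (1, 0). No branch of the argument
  has to be chosen.\<close>

lemma polar_lift:
  fixes x y \<theta> :: "real \<Rightarrow> real"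
  assumes x: "\<And>r. r \<in> {a..b} \<Longrightarrow> (x has_real_derivative x' r) (at r within {a..b})"
    and y: "\<And>r. r \<in> {a..b} \<Longrightarrow> (y has_real_derivative y' r) (at r within {a..b})"
    and \<theta>: "\<And>r. r \<in> {a..b} \<Longrightarrow>
      (\<theta> has_real_derivative (x r * y' r - y r * x' r) / ((x r)\<^sup>2 + (y r)\<^sup>2)) (at r within {a..b})"
    and pos: "\<And>r. r \<in> {a..b} \<Longrightarrow> 0 < (x r)\<^sup>2 + (y r)\<^sup>2"
    and start: "y a = 0" "0 < x a" "\<theta> a = 0" and r: "r \<in> {a..b}"
  shows "x r = sqrt ((x r)\<^sup>2 + (y r)\<^sup>2) * cos (\<theta> r)" "y r = sqrt ((x r)\<^sup>2 + (y r)\<^sup>2) * sin (\<theta> r)"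
proof -
  define s where "s = (\<lambda>r. sqrt ((x r)\<^sup>2 + (y r)\<^sup>2))"
  define \<theta>' where "\<theta>' = (\<lambda>r. (x r * y' r - y r * x' r) / ((x r)\<^sup>2 + (y r)\<^sup>2))"
  define s' where "s' = (\<lambda>r. (x r * x' r + y r * y' r) / s r)"
  have s_pos: "0 < s r" and s2: "(s r)\<^sup>2 = (x r)\<^sup>2 + (y r)\<^sup>2" if "r \<in> {a..b}" for r
    using pos[OF that] by (simp_all add: s_def)
  have \<theta>'s: "\<theta>' r * (s r)\<^sup>2 = x r * y' r - y r * x' r" if "r \<in> {a..b}" for r
    using pos[OF that] s2[OF that] by (simp add: \<theta>'_def)
  have s's: "s' r * s r = x r * x' r + y r * y' r" if "r \<in> {a..b}" for r
    using s_pos[OF that] by (simp add: s'_def)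
  have s: "(s has_real_derivative s' r) (at r within {a..b})" if "r \<in> {a..b}" for r
  proof -
    have "(s has_real_derivative (inverse (sqrt ((x r)\<^sup>2 + (y r)\<^sup>2)) / 2) * (2 * x r * x' r + 2 * y r * y' r))
        (at r within {a..b})"
      unfolding s_def using pos[OF that]
      by (intro DERIV_chain2[where f = sqrt] DERIV_real_sqrt)
        (auto intro!: derivative_eq_intros x y that)
    moreover have "inverse S / 2 * (2 * c * c' + 2 * d * d') = (c * c' + d * d') / S" for S c c' d d' :: real
      by (cases "S = 0") (simp_all add: field_simps)
    ultimately show ?thesis unfolding s'_def s_def by (simp only:)
  qed
  have \<theta>d: "(\<theta> has_real_derivative \<theta>' r) (at r within {a..b})" if "r \<in> {a..b}" for r
    unfolding \<theta>'_def by (rule \<theta>[OF that])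
  have const: "\<exists>c. \<forall>r\<in>{a..b}. f r = c"
    if "\<And>r. r \<in> {a..b} \<Longrightarrow> (f has_real_derivative 0) (at r within {a..b})" for f :: "real \<Rightarrow> real"
    using that by (intro has_field_derivative_zero_constant) auto
  have "((\<lambda>r. (x r * cos (\<theta> r) + y r * sin (\<theta> r)) / s r) has_real_derivative 0) (at r within {a..b})"
    if r: "r \<in> {a..b}" for r
  proof -
    \<comment> \<open>The derivative of the first rotated component before normalisation.
      Multiplying the numerator of the quotient rule by \<open>s r\<close> produces
      \<open>\<theta>' r\<close> times the square of \<open>s r\<close>, and
      \<open>s' r * s r\<close>; both are free of quotients and roots.\<close>
    define N where "N = x' r * cos (\<theta> r) - x r * (sin (\<theta> r) * \<theta>' r) + y' r * sin (\<theta> r) + y r * (cos (\<theta> r) * \<theta>' r)"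
    have "(N * s r - (x r * cos (\<theta> r) + y r * sin (\<theta> r)) * s' r) * s r
        = N * (s r)\<^sup>2 - (x r * cos (\<theta> r) + y r * sin (\<theta> r)) * (s' r * s r)"
      by (simp add: algebra_simps power2_eq_square)
    also have "N * (s r)\<^sup>2 = (x' r * cos (\<theta> r) + y' r * sin (\<theta> r)) * (s r)\<^sup>2
        + (y r * cos (\<theta> r) - x r * sin (\<theta> r)) * (\<theta>' r * (s r)\<^sup>2)"
      by (simp add: N_def algebra_simps)
    also have "\<dots> - (x r * cos (\<theta> r) + y r * sin (\<theta> r)) * (s' r * s r) = 0"
      unfolding \<theta>'s[OF r] s's[OF r] unfolding s2[OF r] by (simp add: algebra_simps power2_eq_square)
    finally have "N * s r - (x r * cos (\<theta> r) + y r * sin (\<theta> r)) * s' r = 0"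
      using s_pos[OF r] by simp
    moreover have "((\<lambda>r. (x r * cos (\<theta> r) + y r * sin (\<theta> r)) / s r) has_real_derivative
        (N * s r - (x r * cos (\<theta> r) + y r * sin (\<theta> r)) * s' r) / (s r * s r)) (at r within {a..b})"
      using s_pos[OF r]
      by (intro DERIV_divide s r)
        (auto intro!: derivative_eq_intros x y \<theta>d r simp: N_def)
    ultimately show ?thesis by simp
  qed
  from const[OF this] obtain c1 where c1: "\<And>r. r \<in> {a..b} \<Longrightarrow> (x r * cos (\<theta> r) + y r * sin (\<theta> r)) / s r = c1"
    by blast
  have "((\<lambda>r. (y r * cos (\<theta> r) - x r * sin (\<theta> r)) / s r) has_real_derivative 0) (at r within {a..b})"
    if r: "r \<in> {a..b}" for r
  proof -
    define N where "N = y' r * cos (\<theta> r) - y r * (sin (\<theta> r) * \<theta>' r) - (x' r * sin (\<theta> r) + x r * (cos (\<theta> r) * \<theta>' r))"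
    have "(N * s r - (y r * cos (\<theta> r) - x r * sin (\<theta> r)) * s' r) * s r
        = N * (s r)\<^sup>2 - (y r * cos (\<theta> r) - x r * sin (\<theta> r)) * (s' r * s r)"
      by (simp add: algebra_simps power2_eq_square)
    also have "N * (s r)\<^sup>2 = (y' r * cos (\<theta> r) - x' r * sin (\<theta> r)) * (s r)\<^sup>2
        - (y r * sin (\<theta> r) + x r * cos (\<theta> r)) * (\<theta>' r * (s r)\<^sup>2)"
      by (simp add: N_def algebra_simps)
    also have "\<dots> - (y r * cos (\<theta> r) - x r * sin (\<theta> r)) * (s' r * s r) = 0"
      unfolding \<theta>'s[OF r] s's[OF r] unfolding s2[OF r] by (simp add: algebra_simps power2_eq_square)
    finally have "N * s r - (y r * cos (\<theta> r) - x r * sin (\<theta> r)) * s' r = 0"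
      using s_pos[OF r] by simp
    moreover have "((\<lambda>r. (y r * cos (\<theta> r) - x r * sin (\<theta> r)) / s r) has_real_derivative
        (N * s r - (y r * cos (\<theta> r) - x r * sin (\<theta> r)) * s' r) / (s r * s r)) (at r within {a..b})"
      using s_pos[OF r]
      by (intro DERIV_divide s r)
        (auto intro!: derivative_eq_intros x y \<theta>d r simp: N_def)
    ultimately show ?thesis by simp
  qed
  from const[OF this] obtain c2 where c2: "\<And>r. r \<in> {a..b} \<Longrightarrow> (y r * cos (\<theta> r) - x r * sin (\<theta> r)) / s r = c2"
    by blast
  have a: "a \<in> {a..b}" using r by auto
  have "c1 = 1" "c2 = 0" using c1[OF a] c2[OF a] start by (simp_all add: s_def)
  then have 1: "x r * cos (\<theta> r) + y r * sin (\<theta> r) = s r" and 2: "y r * cos (\<theta> r) - x r * sin (\<theta> r) = 0"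
    using c1[OF r] c2[OF r] s_pos[OF r] by auto
  have sc: "sin (\<theta> r) * sin (\<theta> r) + cos (\<theta> r) * cos (\<theta> r) = 1"
    using sin_cos_squared_add[of "\<theta> r"] by (simp add: power2_eq_square)
  \<comment> \<open>The inverse rotation, which recovers x and y from the constant
    components.\<close>
  have rot: "X * (S * S + C * C) = (X * C + Y * S) * C - (Y * C - X * S) * S"
    "Y * (S * S + C * C) = (X * C + Y * S) * S + (Y * C - X * S) * C" for X Y S C :: real
    by (simp_all add: algebra_simps)
  have "x r = s r * cos (\<theta> r)"
    using rot(1)[of "x r" "sin (\<theta> r)" "cos (\<theta> r)" "y r"] unfolding 1 2 sc by simp
  then show "x r = sqrt ((x r)\<^sup>2 + (y r)\<^sup>2) * cos (\<theta> r)" unfolding s_def .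
  have "y r = s r * sin (\<theta> r)"
    using rot(2)[of "y r" "sin (\<theta> r)" "cos (\<theta> r)" "x r"] unfolding 1 2 sc by simp
  then show "y r = sqrt ((x r)\<^sup>2 + (y r)\<^sup>2) * sin (\<theta> r)" unfolding s_def .
qed

text \<open>\<open>B'\<close> and \<open>G\<close> are parameters so that explicit formulas can be
  supplied for concrete coefficients. Continuity of \<open>G\<close> is what makes the potential q
  bounded.\<close>

locale liouville_sl = regular_sl +
  fixes B' G :: "real \<Rightarrow> real"
  assumes B': "\<And>r. r \<in> {a..b} \<Longrightarrow>
      ((\<lambda>r. (p r * \<rho> r) powr (1/4)) has_real_derivative B' r) (at r within {a..b})"
    and G: "\<And>r. r \<in> {a..b} \<Longrightarrow>
      ((\<lambda>r. p r * B' r / sqrt (p r * \<rho> r)) has_real_derivative G r) (at r within {a..b})"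
    and cont_G: "continuous_on {a..b} G"
begin

(* g = B' / omega, so that v = u' / omega; G = g', and q is the potential of the transformed
   equation. *)
definition B :: "real \<Rightarrow> real" where "B r = (p r * \<rho> r) powr (1/4)"
definition \<omega> :: "real \<Rightarrow> real" where "\<omega> r = sqrt (\<rho> r / p r)"
definition g :: "real \<Rightarrow> real" where "g r = p r * B' r / sqrt (p r * \<rho> r)"
definition q :: "real \<Rightarrow> real" where "q r = G r * p r / B r ^ 3"
definition \<xi> :: "real \<Rightarrow> real" where "\<xi> r = integral {a..r} \<omega>"
definition u :: "real \<Rightarrow> real \<Rightarrow> real" where "u \<kappa> r = B r * U (\<kappa>\<^sup>2) r"
definition v :: "real \<Rightarrow> real \<Rightarrow> real" where "v \<kappa> r = g r * U (\<kappa>\<^sup>2) r + P (\<kappa>\<^sup>2) r / B r"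
definition n :: "real \<Rightarrow> real \<Rightarrow> real" where "n \<kappa> r = (v \<kappa> r)\<^sup>2 + (\<kappa> * u \<kappa> r)\<^sup>2"
text \<open>The angle is defined by integrating the derivative that it must have, not as an argument
  of the vector. Continuity in r and \<kappa> and the start at 0 come for free, and
  \<open>polar_lift\<close> identifies it as a polar angle afterwards.\<close>

definition \<Theta> :: "real \<Rightarrow> real \<Rightarrow> real" where
  "\<Theta> \<kappa> r = integral {a..r} (\<lambda>s. \<kappa> * \<omega> s - \<kappa> * (q s * \<omega> s) * (u \<kappa> s)\<^sup>2 / n \<kappa> s)"

lemma B_pos: "r \<in> {a..b} \<Longrightarrow> 0 < B r"
  using p_pos[of r] rho_pos[of r] by (auto simp: B_def)

lemma \<omega>_pos: "r \<in> {a..b} \<Longrightarrow> 0 < \<omega> r"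
  using p_pos[of r] rho_pos[of r] by (auto simp: \<omega>_def)

lemma B_sq:
  assumes "r \<in> {a..b}"
  shows "(B r)\<^sup>2 = sqrt (p r * \<rho> r)"
proof -
  have "0 < p r * \<rho> r" using p_pos[OF assms] rho_pos[OF assms] by simp
  then have "(B r)\<^sup>2 = (p r * \<rho> r) powr (1/4 * real 2)"
    by (simp only: B_def powr_realpow[symmetric] powr_powr powr_gt_zero)
  then show ?thesis using \<open>0 < p r * \<rho> r\<close> by (simp add: powr_half_sqrt)
qed

lemma
  assumes "r \<in> {a..b}"
  shows \<omega>_eq: "\<omega> r = (B r)\<^sup>2 / p r" and rho_eq: "\<rho> r = (B r)\<^sup>2 * \<omega> r"
    and g_eq: "g r = p r * B' r / (B r)\<^sup>2"
proof -
  note pos = p_pos[OF assms] rho_pos[OF assms]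
  have \<omega>2: "\<omega> r * \<omega> r = \<rho> r / p r" and "0 \<le> \<omega> r"
    using pos by (simp_all add: \<omega>_def)
  have "sqrt (p r * \<rho> r) = p r * \<omega> r"
  proof (rule real_sqrt_unique)
    have "(p r * \<omega> r)\<^sup>2 = p r * p r * (\<omega> r * \<omega> r)" by (simp add: power2_eq_square)
    then show "(p r * \<omega> r)\<^sup>2 = p r * \<rho> r" using pos by (simp add: \<omega>2)
  qed (use pos \<open>0 \<le> \<omega> r\<close> in simp)
  moreover from this have "sqrt (p r * \<rho> r) * \<omega> r = \<rho> r"
    using pos \<omega>2 by (simp add: mult.assoc)
  ultimately show "\<omega> r = (B r)\<^sup>2 / p r" "\<rho> r = (B r)\<^sup>2 * \<omega> r" "g r = p r * B' r / (B r)\<^sup>2"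
    using pos by (simp_all add: B_sq[OF assms] g_def)
qed

lemma B_deriv: "r \<in> {a..b} \<Longrightarrow> (B has_real_derivative B' r) (at r within {a..b})"
  using B' by (simp add: B_def[abs_def])

lemma g_deriv: "r \<in> {a..b} \<Longrightarrow> (g has_real_derivative G r) (at r within {a..b})"
  using G by (simp add: g_def[abs_def])

lemma cont_B: "continuous_on {a..b} B"
  by (rule DERIV_continuous_on[OF B_deriv])

lemma cont_g: "continuous_on {a..b} g"
  by (rule DERIV_continuous_on[OF g_deriv])

lemma cont_\<omega>: "continuous_on {a..b} \<omega>"
  unfolding \<omega>_def[abs_def] by (intro continuous_intros cont_rho cont_p) (auto simp: p_nz)

lemma cont_q: "continuous_on {a..b} q"
  unfolding q_def[abs_def]
  by (intro continuous_intros cont_G cont_p cont_B) (use B_pos in fastforce)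

lemma \<xi>_deriv: "r \<in> {a..b} \<Longrightarrow> (\<xi> has_real_derivative \<omega> r) (at r within {a..b})"
  unfolding \<xi>_def[abs_def] by (rule integral_has_real_derivative[OF cont_\<omega>])

lemma \<xi>_left: "\<xi> a = 0"
  by (simp add: \<xi>_def)

lemma \<xi>_right_pos: "0 < \<xi> b"
  using integral_eq_0_iff[OF cont_\<omega> ab] integral_nonneg[OF integrable_continuous_real[OF cont_\<omega>]]
    \<omega>_pos ab less_imp_le[OF \<omega>_pos]
  unfolding \<xi>_def by (smt (verit) atLeastAtMost_iff)

section \<open>The first-order system, its squared modulus and its angle\<close>

lemma u_deriv:
  assumes r: "r \<in> {a..b}"
  shows "(u \<kappa> has_real_derivative \<omega> r * v \<kappa> r) (at r within {a..b})"
proof -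
  have "(u \<kappa> has_real_derivative B' r * U (\<kappa>\<^sup>2) r + P (\<kappa>\<^sup>2) r / p r * B r) (at r within {a..b})"
    unfolding u_def[abs_def] by (rule DERIV_mult[OF B_deriv[OF r] U_deriv[OF r]])
  then show ?thesis
    by (rule DERIV_cong)
      (use B_pos[OF r] p_pos[OF r] in \<open>simp add: v_def g_eq[OF r] \<omega>_eq[OF r] field_simps power2_eq_square\<close>)
qed

text \<open>The two terms with \<open>P\<close> cancel because g = p B' /
  \<open>(B r)\<^sup>2\<close>; the exponent 1/4 in \<open>B\<close> is chosen for this. What
  \<open>G\<close> contributes is q \<omega> u, where q is the second derivative of B with respect
  to \<xi>, divided by B.\<close>

lemma v_deriv:
  assumes r: "r \<in> {a..b}"
  shows "(v \<kappa> has_real_derivative - (\<kappa>\<^sup>2 - q r) * \<omega> r * u \<kappa> r) (at r within {a..b})"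
proof -
  have Br: "B r \<noteq> 0" using B_pos[OF r] by simp
  have "(v \<kappa> has_real_derivative (G r * U (\<kappa>\<^sup>2) r + P (\<kappa>\<^sup>2) r / p r * g r)
      + (- \<kappa>\<^sup>2 * \<rho> r * U (\<kappa>\<^sup>2) r * B r - P (\<kappa>\<^sup>2) r * B' r) / (B r * B r)) (at r within {a..b})"
    unfolding v_def[abs_def]
    by (intro DERIV_add DERIV_mult DERIV_divide g_deriv U_deriv P_deriv B_deriv r Br)
  then show ?thesis
    by (rule DERIV_cong)
      (use Br p_nz[OF r] in \<open>simp add: u_def g_eq[OF r] rho_eq[OF r] \<omega>_eq[OF r] q_def
        field_simps power2_eq_square power3_eq_cube\<close>)
qed

lemma u_left: "u \<kappa> a = 0" and v_left: "v \<kappa> a = 1 / B a"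
  by (simp_all add: u_def v_def U_left P_left)

lemma n_left: "n \<kappa> a = (1 / B a)\<^sup>2"
  by (simp add: n_def u_left v_left)

text \<open>The contributions with the square of \<kappa> cancel between the two summands of
  \<open>n\<close>, so only q changes the modulus.\<close>

lemma n_deriv:
  assumes r: "r \<in> {a..b}"
  shows "(n \<kappa> has_real_derivative 2 * (q r * \<omega> r) * (u \<kappa> r * v \<kappa> r)) (at r within {a..b})"
  unfolding n_def[abs_def]
  by (rule derivative_eq_intros refl u_deriv v_deriv r)+ (simp add: algebra_simps power2_eq_square)

text \<open>Since 2 \<kappa> |u v| is at most \<open>n\<close>, the derivative of \<open>n\<close>
  is at most Q / \<kappa> times \<open>n\<close> in absolute value, and Gronwall applies in both
  directions.\<close>

lemma n_growth:
  assumes "0 < \<kappa>" and Q: "\<And>r. r \<in> {a..b} \<Longrightarrow> \<bar>q r * \<omega> r\<bar> \<le> Q" and r: "r \<in> {a..b}"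
  shows "n \<kappa> a * exp (- (Q / \<kappa>) * (r - a)) \<le> n \<kappa> r" "n \<kappa> r \<le> n \<kappa> a * exp (Q / \<kappa> * (r - a))"
proof -
  have "\<bar>2 * (q r * \<omega> r) * (u \<kappa> r * v \<kappa> r)\<bar> \<le> Q / \<kappa> * n \<kappa> r" if r: "r \<in> {a..b}" for r
  proof -
    have "\<bar>2 * (\<kappa> * u \<kappa> r * v \<kappa> r)\<bar> \<le> n \<kappa> r"
      using sum_squares_bound[of "\<kappa> * u \<kappa> r" "v \<kappa> r"] sum_squares_bound[of "- (\<kappa> * u \<kappa> r)" "v \<kappa> r"]
      by (simp add: n_def abs_le_iff mult.assoc)
    then have "\<bar>q r * \<omega> r\<bar> * \<bar>2 * (\<kappa> * u \<kappa> r * v \<kappa> r)\<bar> \<le> Q * n \<kappa> r"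
      using Q[OF r] by (intro mult_mono) auto
    then show ?thesis
      using \<open>0 < \<kappa>\<close> by (simp add: abs_mult field_simps)
  qed
  note le = this
  show "n \<kappa> a * exp (- (Q / \<kappa>) * (r - a)) \<le> n \<kappa> r"
    proof (rule gronwall_lower[OF n_deriv _ r])
    show "- (Q / \<kappa>) * n \<kappa> x \<le> 2 * (q x * \<omega> x) * (u \<kappa> x * v \<kappa> x)" if "x \<in> {a..b}" for x
      using le[OF that] by linarith
  qed
  show "n \<kappa> r \<le> n \<kappa> a * exp (Q / \<kappa> * (r - a))"
    proof (rule gronwall_upper[OF n_deriv _ r])
    show "2 * (q x * \<omega> x) * (u \<kappa> x * v \<kappa> x) \<le> Q / \<kappa> * n \<kappa> x" if "x \<in> {a..b}" for x
      using le[OF that] by linarith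
  qed
qed

lemma q\<omega>_bound:
  obtains Q where "0 \<le> Q" "\<And>r. r \<in> {a..b} \<Longrightarrow> \<bar>q r * \<omega> r\<bar> \<le> Q"
  using continuous_on_Icc_abs_bound[OF continuous_on_mult[OF cont_q cont_\<omega>]] by blast

lemma n_pos:
  assumes "0 < \<kappa>" "r \<in> {a..b}"
  shows "0 < n \<kappa> r"
proof -
  obtain Q where "\<And>r. r \<in> {a..b} \<Longrightarrow> \<bar>q r * \<omega> r\<bar> \<le> Q" using q\<omega>_bound by blast
  from n_growth(1)[OF assms(1) this assms(2)] show ?thesis
    using B_pos[of a] ab by (smt (verit) atLeastAtMost_iff exp_gt_zero mult_pos_pos n_left
        zero_less_divide_1_iff zero_less_power)
qed

lemma cont_u: "continuous_on {a..b} (u \<kappa>)" and cont_n: "continuous_on {a..b} (n \<kappa>)"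
  by (rule DERIV_continuous_on[OF u_deriv] DERIV_continuous_on[OF n_deriv], assumption)+

lemma \<Theta>_deriv:
  assumes "0 < \<kappa>" "r \<in> {a..b}"
  shows "(\<Theta> \<kappa> has_real_derivative \<kappa> * \<omega> r - \<kappa> * (q r * \<omega> r) * (u \<kappa> r)\<^sup>2 / n \<kappa> r) (at r within {a..b})"
  unfolding \<Theta>_def[abs_def]
  by (rule integral_has_real_derivative[OF _ assms(2)])
    (intro continuous_intros cont_\<omega> cont_q cont_u cont_n, use n_pos[OF assms(1)] in fastforce)

lemma \<Theta>_left: "\<Theta> \<kappa> a = 0"
  by (simp add: \<Theta>_def)

lemma polar:
  assumes l: "0 < \<kappa>" and r: "r \<in> {a..b}"
  shows "v \<kappa> r = sqrt (n \<kappa> r) * cos (\<Theta> \<kappa> r)" "\<kappa> * u \<kappa> r = sqrt (n \<kappa> r) * sin (\<Theta> \<kappa> r)"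
proof -
  have y: "((\<lambda>r. \<kappa> * u \<kappa> r) has_real_derivative \<kappa> * (\<omega> r * v \<kappa> r)) (at r within {a..b})"
    if "r \<in> {a..b}" for r by (rule DERIV_cmult[OF u_deriv[OF that]])
  have t: "(\<Theta> \<kappa> has_real_derivative (v \<kappa> r * (\<kappa> * (\<omega> r * v \<kappa> r)) - \<kappa> * u \<kappa> r * (- (\<kappa>\<^sup>2 - q r) * \<omega> r * u \<kappa> r))
      / ((v \<kappa> r)\<^sup>2 + (\<kappa> * u \<kappa> r)\<^sup>2)) (at r within {a..b})" if r: "r \<in> {a..b}" for r
  proof (rule DERIV_cong[OF \<Theta>_deriv[OF l r]])
    have "(\<kappa> * \<omega> r - \<kappa> * (q r * \<omega> r) * (u \<kappa> r)\<^sup>2 / n \<kappa> r)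
        = (\<kappa> * \<omega> r * n \<kappa> r - \<kappa> * (q r * \<omega> r) * (u \<kappa> r)\<^sup>2) / n \<kappa> r"
      using n_pos[OF l r] by (simp add: diff_divide_distrib)
    also have "\<kappa> * \<omega> r * n \<kappa> r - \<kappa> * (q r * \<omega> r) * (u \<kappa> r)\<^sup>2
        = v \<kappa> r * (\<kappa> * (\<omega> r * v \<kappa> r)) - \<kappa> * u \<kappa> r * (- (\<kappa>\<^sup>2 - q r) * \<omega> r * u \<kappa> r)"
      by (simp add: n_def algebra_simps power2_eq_square)
    finally show "(\<kappa> * \<omega> r - \<kappa> * (q r * \<omega> r) * (u \<kappa> r)\<^sup>2 / n \<kappa> r)
        = (v \<kappa> r * (\<kappa> * (\<omega> r * v \<kappa> r)) - \<kappa> * u \<kappa> r * (- (\<kappa>\<^sup>2 - q r) * \<omega> r * u \<kappa> r))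
      / ((v \<kappa> r)\<^sup>2 + (\<kappa> * u \<kappa> r)\<^sup>2)" by (simp add: n_def)
  qed
  have "0 < v \<kappa> a" using B_pos[of a] ab by (simp add: v_left)
  then show "v \<kappa> r = sqrt (n \<kappa> r) * cos (\<Theta> \<kappa> r)" "\<kappa> * u \<kappa> r = sqrt (n \<kappa> r) * sin (\<Theta> \<kappa> r)"
    using polar_lift[OF v_deriv y t _ _ _ _ r] n_pos[OF l] by (simp_all add: n_def u_left \<Theta>_left)
qed

text \<open>The square of \<kappa> u is at most \<open>n\<close>, so the q-term in the derivative of
  the angle is at most Q / \<kappa>.\<close>

lemma \<Theta>_approx:
  assumes l: "0 < \<kappa>" and Q: "\<And>r. r \<in> {a..b} \<Longrightarrow> \<bar>q r * \<omega> r\<bar> \<le> Q" and r: "r \<in> {a..b}"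
  shows "\<bar>\<Theta> \<kappa> r - \<kappa> * \<xi> r\<bar> \<le> Q / \<kappa> * (r - a)"
proof -
  have "\<bar>(\<Theta> \<kappa> r - \<kappa> * \<xi> r) - (\<Theta> \<kappa> a - \<kappa> * \<xi> a)\<bar> \<le> Q / \<kappa> * r - Q / \<kappa> * a"
  proof (rule abs_deriv_le_imp_abs_diff_le[OF _ DERIV_cmult_Id,
        where f = "\<lambda>r. \<Theta> \<kappa> r - \<kappa> * \<xi> r"])
    show "((\<lambda>r. \<Theta> \<kappa> r - \<kappa> * \<xi> r) has_real_derivative
        (\<kappa> * \<omega> r - \<kappa> * (q r * \<omega> r) * (u \<kappa> r)\<^sup>2 / n \<kappa> r) - \<kappa> * \<omega> r) (at r within {a..b})"
      if "r \<in> {a..b}" for r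
      by (intro DERIV_diff DERIV_cmult \<Theta>_deriv \<xi>_deriv l that)
    fix s assume s: "s \<in> {a..b}"
    have "(\<kappa> * u \<kappa> s)\<^sup>2 / n \<kappa> s \<le> 1"
      using n_pos[OF l s] by (simp add: n_def)
    then have "\<bar>q s * \<omega> s\<bar> * ((\<kappa> * u \<kappa> s)\<^sup>2 / n \<kappa> s) \<le> Q * 1"
      using Q[OF s] n_pos[OF l s] by (intro mult_mono) auto
    then have "\<bar>q s * \<omega> s\<bar> * ((\<kappa> * u \<kappa> s)\<^sup>2 / n \<kappa> s) / \<kappa> \<le> Q / \<kappa>"
      using l by (intro divide_right_mono) auto
    moreover have "\<bar>(\<kappa> * \<omega> s - \<kappa> * (q s * \<omega> s) * (u \<kappa> s)\<^sup>2 / n \<kappa> s) - \<kappa> * \<omega> s\<bar>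
        = \<bar>q s * \<omega> s\<bar> * ((\<kappa> * u \<kappa> s)\<^sup>2 / n \<kappa> s) / \<kappa>"
      using l n_pos[OF l s] by (simp add: abs_mult abs_divide power2_eq_square)
    ultimately show "\<bar>(\<kappa> * \<omega> s - \<kappa> * (q s * \<omega> s) * (u \<kappa> s)\<^sup>2 / n \<kappa> s) - \<kappa> * \<omega> s\<bar> \<le> Q / \<kappa>"
      by (simp only:)
  qed (use r in auto)
  then show ?thesis by (simp add: \<Theta>_left \<xi>_left right_diff_distrib)
qed

end

section \<open>Indexing the eigenvalues by the Pruefer angle\<close>

lemma sgn_sin_eq: "\<bar>x\<bar> < pi \<Longrightarrow> sgn (sin x) = sgn (x :: real)"
  using sin_gt_zero[of x] sin_gt_zero[of "- x"]
  by (cases x "0 :: real" rule: linorder_cases) auto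

text \<open>By strong induction a preimage j of m is at least m, as smaller indices are fixed. If j
  exceeded m, then \<open>K m\<close> would lie below m and be a fixed point, against strict
  monotonicity applied to \<open>K m\<close> and m.\<close>

lemma strict_mono_surj_eq_self:
  fixes K :: "nat \<Rightarrow> nat"
  assumes mono: "\<And>i j. 1 \<le> i \<Longrightarrow> i < j \<Longrightarrow> K i < K j"
    and pos: "\<And>i. 1 \<le> i \<Longrightarrow> 1 \<le> K i"
    and surj: "\<And>k. 1 \<le> k \<Longrightarrow> \<exists>i\<ge>1. K i = k"
    and "1 \<le> m"
  shows "K m = m"
  using \<open>1 \<le> m\<close>
proof (induction m rule: less_induct)
  case (less m)
  obtain j where j: "1 \<le> j" "K j = m" using surj[OF less.prems] by blast
  have "m \<le> j" using less.IH[of j] j by force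
  moreover have "\<not> m < j"
  proof
    assume "m < j"
    then have "K m < m" using mono[OF less.prems, of j] j by simp
    moreover from this have "K (K m) = K m" using less.IH pos[OF less.prems] by simp
    moreover have "K (K m) < K m" using mono[OF pos[OF less.prems] calculation(1)] .
    ultimately show False by simp
  qed
  ultimately show ?case using j by simp
qed

context liouville_sl
begin

section \<open>Signs of \<open>U\<close> and \<open>P\<close> and the range of the angle\<close>

lemma sgn_U:
  assumes "0 < \<kappa>" "r \<in> {a..b}"
  shows "sgn (U (\<kappa>\<^sup>2) r) = sgn (sin (\<Theta> \<kappa> r))"
proof -
  have "sgn (\<kappa> * u \<kappa> r) = sgn (sin (\<Theta> \<kappa> r))"
    using polar(2)[OF assms] n_pos[OF assms] by (simp add: sgn_mult)
  then show ?thesis using assms B_pos[OF assms(2)] by (simp add: u_def sgn_mult)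
qed

lemma U_zero_iff:
  assumes "0 < \<kappa>" "r \<in> {a..b}"
  shows "U (\<kappa>\<^sup>2) r = 0 \<longleftrightarrow> sin (\<Theta> \<kappa> r) = 0"
  using sgn_U[OF assms] by (metis sgn_0_0)

lemma sgn_P:
  assumes "0 < \<kappa>" "r \<in> {a..b}" "U (\<kappa>\<^sup>2) r = 0"
  shows "sgn (P (\<kappa>\<^sup>2) r) = sgn (cos (\<Theta> \<kappa> r))"
proof -
  have "P (\<kappa>\<^sup>2) r / B r = sqrt (n \<kappa> r) * cos (\<Theta> \<kappa> r)"
    using polar(1)[OF assms(1,2)] assms(3) by (simp add: v_def)
  then have "sgn (P (\<kappa>\<^sup>2) r / B r) = sgn (sqrt (n \<kappa> r) * cos (\<Theta> \<kappa> r))" by simp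
  then show ?thesis using n_pos[OF assms(1,2)] B_pos[OF assms(2)] by (simp add: sgn_mult sgn_divide)
qed

lemma cont_\<Theta>:
  assumes "0 < \<kappa>"
  shows "continuous_on {a..b} (\<Theta> \<kappa>)"
  by (rule DERIV_continuous_on[OF \<Theta>_deriv[OF assms]])

text \<open>Where the angle is 0, u vanishes and with it the q-term, so the slope there is \<kappa>
  \<omega> > 0: level 0 is only crossed upwards, although the angle may decrease elsewhere.\<close>

lemma \<Theta>_pos:
  assumes l: "0 < \<kappa>" and r: "r \<in> {a<..b}"
  shows "0 < \<Theta> \<kappa> r"
proof (rule upcrossing_stays_above[where f = "\<Theta> \<kappa>" and s = a])
  show "continuous_on {a..r} (\<Theta> \<kappa>)"
    by (rule continuous_on_subset[OF cont_\<Theta>[OF l]]) (use r in auto)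
  have D: "(\<Theta> \<kappa> has_real_derivative \<kappa> * \<omega> x) (at x within {a..b})" "0 < \<kappa> * \<omega> x"
    if "x \<in> {a..b}" "\<Theta> \<kappa> x = 0" for x
  proof -
    have "u \<kappa> x = 0" using polar(2)[OF l that(1)] that l by simp
    then show "(\<Theta> \<kappa> has_real_derivative \<kappa> * \<omega> x) (at x within {a..b})"
      using \<Theta>_deriv[OF l that(1)] by simp
  qed (use \<omega>_pos that l in simp)
  show "eventually (\<lambda>y. 0 < \<Theta> \<kappa> y) (at_right x)" if x: "x \<in> {a..<r}" "\<Theta> \<kappa> x = 0" for x
  proof -
    have xb: "x \<in> {a..b}" using x r by auto
    obtain d where d: "0 < d" "\<And>h. 0 < h \<Longrightarrow> x + h \<in> {a..b} \<Longrightarrow> h < d \<Longrightarrow> \<Theta> \<kappa> x < \<Theta> \<kappa> (x + h)"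
      using has_real_derivative_pos_inc_right[OF D[OF xb x(2)]] by blast
    have "0 < \<Theta> \<kappa> y" if "x < y" "y < min (x + d) b" for y
      using d(2)[of "y - x"] that x by auto
    moreover have "x < min (x + d) b" using d x r by auto
    ultimately show ?thesis unfolding eventually_at_right_field by blast
  qed
  show "eventually (\<lambda>y. \<Theta> \<kappa> y < 0) (at_left x)" if x: "x \<in> {a<..r}" "\<Theta> \<kappa> x = 0" for x
  proof -
    have xb: "x \<in> {a..b}" using x r by auto
    obtain d where d: "0 < d" "\<And>h. 0 < h \<Longrightarrow> x - h \<in> {a..b} \<Longrightarrow> h < d \<Longrightarrow> \<Theta> \<kappa> (x - h) < \<Theta> \<kappa> x"
      using has_real_derivative_pos_inc_left[OF D[OF xb x(2)]] by blast
    have "\<Theta> \<kappa> y < 0" if "max (x - d) a < y" "y < x" for y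
      using d(2)[of "x - y"] that x xb by auto
    moreover have "max (x - d) a < x" using d x r by auto
    ultimately show ?thesis unfolding eventually_at_left_field by blast
  qed
qed (use r in \<open>auto simp: \<Theta>_left\<close>)

lemma \<Theta>_less_pi:
  assumes l: "0 < \<kappa>" and U: "\<And>r. r \<in> {a<..b} \<Longrightarrow> 0 < U (\<kappa>\<^sup>2) r"
  shows "\<Theta> \<kappa> b < pi"
proof (rule ccontr)
  assume "\<not> \<Theta> \<kappa> b < pi"
  then obtain r where r: "a \<le> r" "r \<le> b" "\<Theta> \<kappa> r = pi"
    using IVT'[of "\<Theta> \<kappa>" a pi b] ab cont_\<Theta>[OF l] by (auto simp: \<Theta>_left)
  then have "r \<noteq> a" using \<Theta>_left[of \<kappa>] pi_gt_zero by force
  moreover have "U (\<kappa>\<^sup>2) r = 0" using U_zero_iff[OF l, of r] r by simp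
  ultimately show False using U[of r] r by force
qed

section \<open>The angle at the right end as a function of \<kappa>\<close>

lemma continuous_\<Theta>_right: "continuous_on {0<..} (\<lambda>\<kappa>. \<Theta> \<kappa> b)"
proof -
  have 1: "continuous_on ({0<..} \<times> {a..b}) (\<lambda>z. f (snd z))"
    if "continuous_on {a..b} f" for f :: "real \<Rightarrow> real"
    by (rule continuous_on_compose2[OF that]) (auto intro: continuous_intros)
  have 2: "continuous_on ({0<..} \<times> {a..b}) (\<lambda>z. U ((fst z)\<^sup>2) (snd z))"
    by (rule continuous_on_compose2[OF continuous_UP(1), of _ "\<lambda>z. ((fst z)\<^sup>2, snd z)", simplified])
      (auto intro!: continuous_intros)
  have 3: "continuous_on ({0<..} \<times> {a..b}) (\<lambda>z. P ((fst z)\<^sup>2) (snd z))"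
    by (rule continuous_on_compose2[OF continuous_UP(2), of _ "\<lambda>z. ((fst z)\<^sup>2, snd z)", simplified])
      (auto intro!: continuous_intros)
  have u: "continuous_on ({0<..} \<times> {a..b}) (\<lambda>z. u (fst z) (snd z))"
    unfolding u_def by (intro continuous_intros 1 2 cont_B)
  have v: "continuous_on ({0<..} \<times> {a..b}) (\<lambda>z. v (fst z) (snd z))"
    unfolding v_def by (intro continuous_intros 1 2 3 cont_B cont_g) (use B_pos in fastforce)
  have n: "continuous_on ({0<..} \<times> {a..b}) (\<lambda>z. n (fst z) (snd z))"
    unfolding n_def by (intro continuous_intros u v)
  have "continuous_on ({0<..} \<times> {a..b}) (\<lambda>z. fst z * \<omega> (snd z)
      - fst z * (q (snd z) * \<omega> (snd z)) * (u (fst z) (snd z))\<^sup>2 / n (fst z) (snd z))"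
    by (intro continuous_intros 1 u n cont_\<omega> cont_q) (use n_pos in fastforce)
  then have "continuous_on {0<..} (\<lambda>\<kappa>. integral (cbox a b)
      (\<lambda>s. \<kappa> * \<omega> s - \<kappa> * (q s * \<omega> s) * (u \<kappa> s)\<^sup>2 / n \<kappa> s))"
    by (intro integral_continuous_on_param) (simp add: case_prod_beta)
  then show ?thesis by (simp add: \<Theta>_def)
qed

text \<open>For \<kappa> near \<nu> the angles differ by less than pi, so the sign of the difference
  is that of its sine. This sine is
  \<open>sin (\<Theta> \<kappa> b) * cos (\<Theta> \<nu> b)\<close>, whose factors have the signs of
  \<open>U\<close> for \<kappa> and \<open>P\<close> for \<nu>, and the Lagrange identity
  decides.\<close>

lemma \<Theta>_right_crossing:
  assumes l: "0 < \<nu>" and z: "sin (\<Theta> \<nu> b) = 0"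
  shows "eventually (\<lambda>\<kappa>. sgn (\<Theta> \<kappa> b - \<Theta> \<nu> b) = sgn (\<kappa> - \<nu>)) (nhds \<nu>)"
proof -
  have b: "b \<in> {a..b}" using ab by simp
  have U0: "U (\<nu>\<^sup>2) b = 0" using U_zero_iff[OF l b] z by simp
  have "filterlim (\<lambda>\<kappa>. \<kappa>\<^sup>2) (nhds (\<nu>\<^sup>2)) (nhds \<nu>)"
    by (intro tendsto_power filterlim_ident)
  with wronskian_sign[OF U0]
  have 1: "eventually (\<lambda>\<kappa>. sgn (U (\<kappa>\<^sup>2) b * P (\<nu>\<^sup>2) b) = sgn (\<kappa>\<^sup>2 - \<nu>\<^sup>2)) (nhds \<nu>)"
    by (rule eventually_compose_filterlim)
  have "isCont (\<lambda>\<kappa>. \<Theta> \<kappa> b) \<nu>"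
    using continuous_\<Theta>_right l by (simp add: continuous_on_eq_continuous_at)
  then have "((\<lambda>\<kappa>. \<Theta> \<kappa> b) \<longlongrightarrow> \<Theta> \<nu> b) (nhds \<nu>)"
    using tendsto_at_iff_tendsto_nhds[of "\<lambda>\<kappa>. \<Theta> \<kappa> b" \<nu>] by (simp add: continuous_at)
  then have 2: "eventually (\<lambda>\<kappa>. dist (\<Theta> \<kappa> b) (\<Theta> \<nu> b) < pi) (nhds \<nu>)"
    by (rule tendstoD) simp
  have 3: "eventually (\<lambda>\<kappa>. 0 < \<kappa>) (nhds \<nu>)"
    using l by (rule eventually_nhds_in_open[OF open_greaterThan, simplified])
  show ?thesis using 1 2 3
  proof eventually_elim
    case (elim \<kappa>)
    have "sgn (\<Theta> \<kappa> b - \<Theta> \<nu> b) = sgn (sin (\<Theta> \<kappa> b - \<Theta> \<nu> b))"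
      using elim(2) by (intro sgn_sin_eq[symmetric]) (simp add: dist_real_def)
    also have "\<dots> = sgn (sin (\<Theta> \<kappa> b) * cos (\<Theta> \<nu> b))" by (simp add: sin_diff z)
    also have "\<dots> = sgn (U (\<kappa>\<^sup>2) b * P (\<nu>\<^sup>2) b)"
      using sgn_U[OF elim(3) b] sgn_P[OF l b U0] by (simp add: sgn_mult)
    also have "\<dots> = sgn ((\<kappa> + \<nu>) * (\<kappa> - \<nu>))"
      unfolding elim(1) by (simp add: algebra_simps power2_eq_square)
    also have "\<dots> = sgn (\<kappa> - \<nu>)" using elim(3) l by (simp add: sgn_mult)
    finally show ?case .
  qed
qed

text \<open>Every later parameter with the same angle also has sine 0 at \<open>b\<close>, hence is
  again an upward crossing; the level cannot be regained from above.\<close>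

lemma \<Theta>_right_less:
  assumes l: "0 < \<nu>" and z: "sin (\<Theta> \<nu> b) = 0" and "\<nu> < \<kappa>"
  shows "\<Theta> \<nu> b < \<Theta> \<kappa> b"
proof (rule upcrossing_stays_above[where f = "\<lambda>\<kappa>. \<Theta> \<kappa> b", OF _ \<open>\<nu> < \<kappa>\<close> order_refl])
  show "continuous_on {\<nu>..\<kappa>} (\<lambda>\<kappa>. \<Theta> \<kappa> b)"
    by (rule continuous_on_subset[OF continuous_\<Theta>_right]) (use l in auto)
  have ev: "eventually (\<lambda>y. sgn (\<Theta> y b - \<Theta> \<nu> b) = sgn (y - x)) (nhds x)"
    if "\<nu> \<le> x" "\<Theta> x b = \<Theta> \<nu> b" for x
    using \<Theta>_right_crossing[of x] that l z by simp
  show "eventually (\<lambda>y. \<Theta> \<nu> b < \<Theta> y b) (at_right x)" if "x \<in> {\<nu>..<\<kappa>}" "\<Theta> x b = \<Theta> \<nu> b" for x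
    using ev[of x] that unfolding eventually_at_filter
    by (auto elim!: eventually_mono simp: sgn_if split: if_splits)
  show "eventually (\<lambda>y. \<Theta> y b < \<Theta> \<nu> b) (at_left x)" if "x \<in> {\<nu><..\<kappa>}" "\<Theta> x b = \<Theta> \<nu> b" for x
    using ev[of x] that unfolding eventually_at_filter
    by (auto elim!: eventually_mono simp: sgn_if split: if_splits)
qed

text \<open>For small parameters the angle is below pi, hence below every level k pi with k at least
  1; the intermediate value theorem does the rest.\<close>

lemma \<Theta>_right_attains:
  assumes l: "0 < \<kappa>" and k: "1 \<le> k" "real k * pi \<le> \<Theta> \<kappa> b"
  shows "\<exists>\<nu>>0. \<Theta> \<nu> b = real k * pi"
proof -
  obtain \<delta> where \<delta>: "0 < \<delta>" "\<And>\<mu> r. \<mu> \<in> {0<..<\<delta>} \<Longrightarrow> r \<in> {a<..b} \<Longrightarrow> 0 < U \<mu> r"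
    using U_pos_of_small by blast
  \<comment> \<open>With s at most 1 its square is at most s < \<delta>, so positivity of
    \<open>U\<close> holds for the spectral parameter, which is the square of s.\<close>
  define s where "s = min (\<kappa> / 2) (min 1 (\<delta> / 2))"
  have s: "0 < s" "s < \<kappa>" "s \<le> 1" "s < \<delta>" using l \<delta> by (auto simp: s_def)
  have "s\<^sup>2 \<le> s * 1" unfolding power2_eq_square using s by (intro mult_left_mono) auto
  then have "s\<^sup>2 \<in> {0<..<\<delta>}" using s by auto
  then have "\<Theta> s b < pi" using \<delta>(2) s by (intro \<Theta>_less_pi) auto
  also have "pi \<le> real k * pi" using k by simp
  finally obtain \<nu> where "s \<le> \<nu>" "\<nu> \<le> \<kappa>" "\<Theta> \<nu> b = real k * pi"
    using IVT'[of "\<lambda>\<kappa>. \<Theta> \<kappa> b" s "real k * pi" \<kappa>] k s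
      continuous_on_subset[OF continuous_\<Theta>_right, of "{s..\<kappa>}"] by fastforce
  then show ?thesis using s by (intro exI[of _ \<nu>]) auto
qed

text \<open>Serves twice: eigenfunctions for the same eigenvalue cannot be orthogonal, and
  normalisation fixes the modulus of the factor in front of \<open>U\<close>.\<close>

lemma weighted_inner_UU:
  assumes "\<And>r. r \<in> {a..b} \<Longrightarrow> f r = c * complex_of_real (U \<mu> r)"
    and "\<And>r. r \<in> {a..b} \<Longrightarrow> h r = d * complex_of_real (U \<mu> r)"
  shows "weighted_inner \<rho> a b f h
    = c * cnj d * complex_of_real (integral {a..b} (\<lambda>r. \<rho> r * U \<mu> r * U \<mu> r))"
proof -
  have "weighted_inner \<rho> a b f h
      = integral {a..b} (\<lambda>r. (c * cnj d) * complex_of_real (\<rho> r * U \<mu> r * U \<mu> r))"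
    unfolding weighted_inner_def by (rule integral_cong) (simp add: assms mult_ac)
  also have "\<dots> = c * cnj d * integral {a..b} (\<lambda>r. complex_of_real (\<rho> r * U \<mu> r * U \<mu> r))"
    by (rule integral_mult_right)
  also have "integral {a..b} (\<lambda>r. complex_of_real (\<rho> r * U \<mu> r * U \<mu> r))
      = complex_of_real (integral {a..b} (\<lambda>r. \<rho> r * U \<mu> r * U \<mu> r))"
    using integral_linear[OF integrable_continuous_real bounded_linear_of_real,
        of a b "\<lambda>r. \<rho> r * U \<mu> r * U \<mu> r"]
    by (simp add: o_def continuous_intros cont_rho cont_U)
  finally show ?thesis .
qed

lemma eigensystem_mono:
  assumes pos: "\<And>m. 1 \<le> m \<Longrightarrow> 0 < lam m"
    and sys: "sl_eigensystem p \<rho> a b (\<lambda>m. (lam m)\<^sup>2) R"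
    and "1 \<le> i" "i \<le> j"
  shows "lam i \<le> lam j"
proof (rule power2_le_imp_le)
  show "(lam i)\<^sup>2 \<le> (lam j)\<^sup>2" using assms by (simp add: sl_eigensystem_def)
  show "0 \<le> lam j" using pos[of j] assms(3,4) by linarith
qed

text \<open>The angle at \<open>lam m\<close> is some multiple \<open>K m\<close> of pi. Strict
  growth of \<open>lam\<close> and upward crossing make \<open>K\<close> strictly increasing; since
  every eigenvalue is listed, \<open>K\<close> also hits every k, and such a map is the
  identity.\<close>

theorem \<Theta>_right_eigenvalue:
  assumes pos: "\<And>m. 1 \<le> m \<Longrightarrow> 0 < lam m"
    and sys: "sl_eigensystem p \<rho> a b (\<lambda>m. (lam m)\<^sup>2) R"
    and m: "1 \<le> m"
  shows "\<Theta> (lam m) b = real m * pi"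
proof -
  have b: "b \<in> {a..b}" using ab by simp
  have ef: "sl_eigenfunction p \<rho> a b ((lam m)\<^sup>2) (R m)" if "1 \<le> m" for m
    using sys that by (simp add: sl_eigensystem_def)
  note le = eigensystem_mono[OF pos sys]
  have all: "\<exists>m\<ge>1. (lam m)\<^sup>2 = \<nu>" if "sl_eigenvalue p \<rho> a b \<nu>" for \<nu>
    using sys that by (simp add: sl_eigensystem_def)
  have orth: "weighted_inner \<rho> a b (R i) (R j) = 0" if "1 \<le> i" "1 \<le> j" "i \<noteq> j" for i j
    using sys that by (simp add: sl_eigensystem_def)
  have less: "lam i < lam j" if ij: "1 \<le> i" "i < j" for i j
  proof -
    obtain c where c: "c \<noteq> 0" "\<And>r. r \<in> {a..b} \<Longrightarrow> R i r = c * complex_of_real (U ((lam i)\<^sup>2) r)"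
      using eigenfunction_eq[OF ef[OF ij(1)]] by metis
    obtain d where d: "d \<noteq> 0" "\<And>r. r \<in> {a..b} \<Longrightarrow> R j r = d * complex_of_real (U ((lam j)\<^sup>2) r)"
      using eigenfunction_eq[OF ef[of j]] ij by (metis less_imp_le order_trans)
    \<comment> \<open>Equal values would make both eigenfunctions nonzero multiples of the same
      \<open>U\<close>, with nonzero inner product.\<close>
    have "lam i \<noteq> lam j"
      using weighted_inner_UU[of "R i" c "(lam i)\<^sup>2" "R j" d] norm_U_pos[of "(lam i)\<^sup>2"] c d
        orth[of i j] that by auto
    then show ?thesis using le[of i j] that by simp
  qed
  have zero: "sin (\<Theta> (lam m) b) = 0" if "1 \<le> m" for m
    using eigenfunction_eq[OF ef[OF that]] U_zero_iff[OF pos[OF that] b] by metis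
  have "\<exists>k::nat. 1 \<le> k \<and> \<Theta> (lam m) b = real k * pi" if m: "1 \<le> m" for m
  proof -
    obtain i :: int where i: "\<Theta> (lam m) b = of_int i * pi"
      using zero[OF m] by (auto simp: sin_zero_iff_int2)
    \<comment> \<open>Positivity of the angle rules out the multiples 0, -1, -2 and so on, which
      fixes the origin of the counting.\<close>
    then have "0 < of_int i * pi" using \<Theta>_pos[OF pos[OF m], of b] ab by simp
    then have "0 < i" by (simp add: zero_less_mult_iff)
    then show ?thesis using i by (intro exI[of _ "nat i"]) auto
  qed
  then obtain K where K: "\<And>m. 1 \<le> m \<Longrightarrow> 1 \<le> K m" "\<And>m. 1 \<le> m \<Longrightarrow> \<Theta> (lam m) b = real (K m) * pi"
    by metis
  have mono: "K i < K j" if "1 \<le> i" "i < j" for i j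
    using \<Theta>_right_less[OF pos[OF that(1)] zero[OF that(1)] less[OF that]] K(2)[of i] K(2)[of j] that
    by simp
  \<comment> \<open>Guarantees that the angle at \<open>lam k\<close> has reached k pi, so that some
    parameter attains this level and is therefore listed.\<close>
  have ge: "m \<le> K m" if "1 \<le> m" for m
    using that
  proof (induction m rule: dec_induct)
    case (step m)
    then show ?case using mono[of m "Suc m"] by simp
  qed (use K in simp)
  have "K m = m"
  proof (rule strict_mono_surj_eq_self[OF mono K(1) _ m])
    fix k :: nat assume k: "1 \<le> k"
    have "real k * pi \<le> \<Theta> (lam k) b" using K(2)[OF k] ge[OF k] by simp
    then obtain \<nu> where \<nu>: "0 < \<nu>" "\<Theta> \<nu> b = real k * pi"
      using \<Theta>_right_attains[OF pos[OF k] k] by blast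
    then have "U (\<nu>\<^sup>2) b = 0" using U_zero_iff[OF \<nu>(1) b] by simp
    then obtain i where i: "1 \<le> i" "(lam i)\<^sup>2 = \<nu>\<^sup>2" using all[OF eigenvalueI] by blast
    then have "lam i = \<nu>" using pos[OF i(1)] \<nu> by (simp add: power2_eq_iff)
    then have "K i = k" using K(2)[OF i(1)] \<nu> by simp
    then show "\<exists>i\<ge>1. K i = k" using i by blast
  qed
  then show ?thesis using K(2)[OF m] by simp
qed

end

section \<open>Asymptotics\<close>

lemma abs_sin_diff_le: "\<bar>sin x - sin y\<bar> \<le> \<bar>x - y\<bar>" for x y :: real
proof -
  have "\<bar>sin t - sin s\<bar> \<le> t - s" if "s \<le> t" for s t :: real
    using abs_deriv_le_imp_abs_diff_le[of s t sin cos "\<lambda>x. x" "\<lambda>_. 1" s t] that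
    by (auto intro: has_field_derivative_at_within DERIV_sin DERIV_ident)
  from this[of x y] this[of y x] show ?thesis by (cases "x \<le> y") (auto simp: abs_minus_commute)
qed

lemma abs_sqrt_minus_1_le:
  assumes "0 \<le> z"
  shows "\<bar>sqrt z - 1\<bar> \<le> \<bar>z - 1\<bar>"
proof -
  have "z - 1 = (sqrt z - 1) * (sqrt z + 1)" using assms by (simp add: algebra_simps)
  then have "\<bar>z - 1\<bar> = \<bar>sqrt z - 1\<bar> * (sqrt z + 1)" using assms by (simp add: abs_mult)
  moreover have "\<bar>sqrt z - 1\<bar> * 1 \<le> \<bar>sqrt z - 1\<bar> * (sqrt z + 1)"
    using assms by (intro mult_left_mono) auto
  ultimately show ?thesis by simp
qed

text \<open>Rationalise the difference of the roots, then bound the denominator below. Converts the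
  estimate for the normalisation integral into one for the normalising factor.\<close>

lemma abs_inverse_sqrt_diff_le:
  assumes "0 < d" "d \<le> x" "d \<le> y"
  shows "\<bar>1 / sqrt x - 1 / sqrt y\<bar> \<le> \<bar>x - y\<bar> / (d * sqrt d)"
proof -
  have pos: "0 < x" "0 < y" using assms by auto
  have "y - x = (sqrt y - sqrt x) * (sqrt y + sqrt x)" using pos by (simp add: algebra_simps)
  then have 1: "\<bar>x - y\<bar> = \<bar>sqrt y - sqrt x\<bar> * (sqrt y + sqrt x)"
    using pos by (simp add: abs_minus_commute[of x y] abs_mult)
  have "\<bar>1 / sqrt x - 1 / sqrt y\<bar> = \<bar>sqrt y - sqrt x\<bar> / (sqrt x * sqrt y)"
    using pos by (simp add: diff_frac_eq abs_divide abs_mult)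
  also have "\<dots> = \<bar>x - y\<bar> / ((sqrt x * sqrt y) * (sqrt y + sqrt x))"
    using pos unfolding 1 by (simp add: add_pos_pos less_imp_neq[symmetric])
  also have "\<dots> \<le> \<bar>x - y\<bar> / (d * sqrt d)"
  proof (intro divide_left_mono mult_mono)
    have "sqrt d * sqrt d \<le> sqrt x * sqrt y" using assms by (intro mult_mono) auto
    then show "d \<le> sqrt x * sqrt y" using assms by simp
    show "sqrt d \<le> sqrt y + sqrt x"
      using assms pos real_sqrt_le_mono[of d y] real_sqrt_ge_zero[of x] by linarith
    have "0 < sqrt y + sqrt x" using pos by (simp add: add_pos_pos)
    then show "0 < sqrt x * sqrt y * (sqrt y + sqrt x) * (d * sqrt d)" using pos assms by simp
  qed (use pos assms in auto)
  finally show ?thesis .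
qed

context liouville_sl
begin

text \<open>The factor \<open>B a\<close> makes the modulus start at 1, because v(a) = 1 / B(a). The
  error splits into the deviation of the modulus from 1 and that of the angle from \<kappa>
  \<xi>.\<close>

lemma u_asymptotics:
  obtains C \<Lambda> where "0 \<le> C" "1 \<le> \<Lambda>"
    "\<And>\<kappa> r. \<Lambda> \<le> \<kappa> \<Longrightarrow> r \<in> {a..b} \<Longrightarrow> \<bar>\<kappa> * B a * u \<kappa> r - sin (\<kappa> * \<xi> r)\<bar> \<le> C / \<kappa>"
proof -
  obtain Q where Q: "0 \<le> Q" "\<And>r. r \<in> {a..b} \<Longrightarrow> \<bar>q r * \<omega> r\<bar> \<le> Q" using q\<omega>_bound by blast
  define t where "t = Q * (b - a)"
  have t: "0 \<le> t" using Q ab by (simp add: t_def)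
  have Ba: "0 < B a" using B_pos[of a] ab by simp
  show thesis
  \<comment> \<open>2 t comes from the modulus and t from the angle; the threshold makes the
    exponent x at most 1/2, where exp x is at most 1 + 2 x.\<close>
  proof (rule that[of "3 * t" "2 * t + 1"])
    fix \<kappa> r assume k: "2 * t + 1 \<le> \<kappa>" and r: "r \<in> {a..b}"
    have l: "0 < \<kappa>" using k t by simp
    define x where "x = Q / \<kappa> * (r - a)"
    have x: "0 \<le> x" "x \<le> t / \<kappa>"
      using Q r l by (auto simp: x_def t_def intro!: divide_right_mono mult_left_mono)
    have "t / \<kappa> \<le> 1 / 2" using k t l by (simp add: field_simps)
    then have x2: "x \<le> 1 / 2" by (rule order_trans[OF x(2)])
    define z where "z = n \<kappa> r * (B a)\<^sup>2"
    have z: "exp (- x) \<le> z" "z \<le> exp x"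
      using mult_right_mono[OF n_growth(1)[OF l Q(2) r], of "(B a)\<^sup>2"]
        mult_right_mono[OF n_growth(2)[OF l Q(2) r], of "(B a)\<^sup>2"] Ba
      by (simp_all add: z_def x_def n_left power_divide)
    have "exp x \<le> 1 + 2 * x" by (rule real_exp_bound_lemma[OF x(1) x2])
    moreover have "1 - x \<le> exp (- x)" using exp_ge_add_one_self[of "- x"] by simp
    ultimately have "\<bar>z - 1\<bar> \<le> 2 * (t / \<kappa>)" using z x by (simp only: abs_le_iff) linarith
    moreover have "0 \<le> z" using z(1) exp_gt_zero[of "- x"] by linarith
    ultimately have z1: "\<bar>sqrt z - 1\<bar> \<le> 2 * (t / \<kappa>)" using abs_sqrt_minus_1_le[of z] by linarith
    have "sqrt z = sqrt (n \<kappa> r) * B a" using Ba by (simp add: z_def real_sqrt_mult)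
    then have "\<kappa> * B a * u \<kappa> r = sqrt z * sin (\<Theta> \<kappa> r)"
      using polar(2)[OF l r] by (simp add: mult_ac)
    then have eq: "\<kappa> * B a * u \<kappa> r - sin (\<kappa> * \<xi> r)
        = (sqrt z - 1) * sin (\<Theta> \<kappa> r) + (sin (\<Theta> \<kappa> r) - sin (\<kappa> * \<xi> r))"
      by (simp add: algebra_simps)
    have "\<bar>\<kappa> * B a * u \<kappa> r - sin (\<kappa> * \<xi> r)\<bar> \<le> \<bar>sqrt z - 1\<bar> * \<bar>sin (\<Theta> \<kappa> r)\<bar> + \<bar>\<Theta> \<kappa> r - \<kappa> * \<xi> r\<bar>"
      using abs_sin_diff_le[of "\<Theta> \<kappa> r" "\<kappa> * \<xi> r"]
        abs_triangle_ineq[of "(sqrt z - 1) * sin (\<Theta> \<kappa> r)" "sin (\<Theta> \<kappa> r) - sin (\<kappa> * \<xi> r)"]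
      unfolding eq abs_mult by linarith
    also have "\<dots> \<le> 2 * (t / \<kappa>) * 1 + t / \<kappa>"
    proof (rule add_mono)
      show "\<bar>sqrt z - 1\<bar> * \<bar>sin (\<Theta> \<kappa> r)\<bar> \<le> 2 * (t / \<kappa>) * 1"
        by (rule mult_mono[OF z1 abs_sin_le_one]) (use t l in simp_all)
      have "\<bar>\<Theta> \<kappa> r - \<kappa> * \<xi> r\<bar> \<le> x"
        unfolding x_def by (rule \<Theta>_approx[OF l Q(2) r])
      then show "\<bar>\<Theta> \<kappa> r - \<kappa> * \<xi> r\<bar> \<le> t / \<kappa>" by (rule order_trans[OF _ x(2)])
    qed
    finally show "\<bar>\<kappa> * B a * u \<kappa> r - sin (\<kappa> * \<xi> r)\<bar> \<le> 3 * t / \<kappa>" by simp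
  qed (use t in auto)
qed

text \<open>As \<rho> is \<open>(B r)\<^sup>2\<close> times \<omega>, the weighted square of
  \<open>U\<close> is \<omega> times the square of u, which is close to \<omega> times a squared
  sine of \<kappa> \<xi> after scaling. Its integral over the whole interval is half of
  \<open>\<xi> b\<close> up to a boundary term of order 1/\<kappa>.\<close>

lemma norm_asymptotics:
  obtains D \<Lambda> where "0 \<le> D" "1 \<le> \<Lambda>"
    "\<And>\<kappa>. \<Lambda> \<le> \<kappa> \<Longrightarrow>
      \<bar>(\<kappa> * B a)\<^sup>2 * integral {a..b} (\<lambda>r. \<rho> r * U (\<kappa>\<^sup>2) r * U (\<kappa>\<^sup>2) r) - \<xi> b / 2\<bar> \<le> D / \<kappa>"
proof -
  obtain C \<Lambda> where C: "0 \<le> C" "1 \<le> \<Lambda>" "\<And>\<kappa> r. \<Lambda> \<le> \<kappa> \<Longrightarrow> r \<in> {a..b} \<Longrightarrow>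
      \<bar>\<kappa> * B a * u \<kappa> r - sin (\<kappa> * \<xi> r)\<bar> \<le> C / \<kappa>" using u_asymptotics by metis
  show thesis
  \<comment> \<open>With X the scaled u and s the sine, |X - s| is at most C / \<kappa> and |X + s|
    at most C + 2; the 1/4 bounds the oscillating boundary term of \<open>h\<close>.\<close>
  proof (rule that[of "C * (C + 2) * \<xi> b + 1/4" \<Lambda>])
    fix \<kappa> assume k: "\<Lambda> \<le> \<kappa>"
    have l: "1 \<le> \<kappa>" using k C by simp
    define f where "f = (\<lambda>r. \<omega> r * (\<kappa> * B a * u \<kappa> r)\<^sup>2)"
    \<comment> \<open>The antiderivative of \<omega> times the squared sine of \<kappa> \<xi>,
      vanishing at \<open>a\<close>.\<close>
    define h where "h = (\<lambda>r. \<xi> r / 2 - sin (2 * \<kappa> * \<xi> r) / (4 * \<kappa>))"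
    have cf: "continuous_on {a..b} f"
      unfolding f_def by (intro continuous_intros cont_\<omega> cont_u)
    have F: "((\<lambda>r. integral {a..r} f - h r) has_real_derivative f r - \<omega> r * (sin (\<kappa> * \<xi> r))\<^sup>2)
        (at r within {a..b})" if r: "r \<in> {a..b}" for r
    proof (rule DERIV_diff[OF integral_has_real_derivative[OF cf r]])
      have hd: "(h has_real_derivative \<omega> r / 2 - cos (2 * \<kappa> * \<xi> r) * (2 * \<kappa> * \<omega> r) / (4 * \<kappa>)) (at r within {a..b})"
        unfolding h_def using l by (auto intro!: derivative_eq_intros \<xi>_deriv r)
      have cos2: "cos (2 * \<kappa> * \<xi> r) = 1 - 2 * (sin (\<kappa> * \<xi> r))\<^sup>2"
        using cos_double_sin[of "\<kappa> * \<xi> r"] by (simp add: mult.assoc)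
      have eq: "\<omega> r / 2 - cos (2 * \<kappa> * \<xi> r) * (2 * \<kappa> * \<omega> r) / (4 * \<kappa>) = \<omega> r * (sin (\<kappa> * \<xi> r))\<^sup>2"
        unfolding cos2 using l by (simp add: field_simps)
      show "(h has_real_derivative \<omega> r * (sin (\<kappa> * \<xi> r))\<^sup>2) (at r within {a..b})"
        by (rule DERIV_cong[OF hd eq])
    qed
    define E where "E = C * (C + 2) / \<kappa>"
    have "\<bar>(integral {a..b} f - h b) - (integral {a..a} f - h a)\<bar> \<le> E * \<xi> b - E * \<xi> a"
    proof (rule abs_deriv_le_imp_abs_diff_le[OF F DERIV_cmult[OF \<xi>_deriv]])
      fix r assume r: "r \<in> {a..b}"
      define X where "X = \<kappa> * B a * u \<kappa> r"
      define s where "s = sin (\<kappa> * \<xi> r)"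
      have Xs: "\<bar>X - s\<bar> \<le> C / \<kappa>" using C(3)[OF k r] by (simp add: X_def s_def)
      have "C / \<kappa> \<le> C" using C l by (simp add: divide_le_eq mult_le_cancel_left1)
      moreover have "\<bar>s\<bar> \<le> 1" by (simp add: s_def)
      ultimately have "\<bar>X + s\<bar> \<le> C + 2" using Xs by linarith
      then have "\<bar>X - s\<bar> * \<bar>X + s\<bar> \<le> C / \<kappa> * (C + 2)"
        using Xs C l by (intro mult_mono) auto
      then have "\<omega> r * (\<bar>X - s\<bar> * \<bar>X + s\<bar>) \<le> \<omega> r * E"
        using \<omega>_pos[OF r] by (intro mult_left_mono) (simp_all add: E_def)
      moreover have "f r - \<omega> r * (sin (\<kappa> * \<xi> r))\<^sup>2 = \<omega> r * ((X - s) * (X + s))"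
        by (simp add: f_def X_def s_def algebra_simps power2_eq_square)
      ultimately show "\<bar>f r - \<omega> r * (sin (\<kappa> * \<xi> r))\<^sup>2\<bar> \<le> E * \<omega> r"
        using \<omega>_pos[OF r] by (simp add: abs_mult mult.commute[of E])
    qed (use ab in auto)
    moreover have "h a = 0" by (simp add: h_def \<xi>_left)
    ultimately have 1: "\<bar>integral {a..b} f - h b\<bar> \<le> E * \<xi> b" by (simp add: \<xi>_left)
    have "\<bar>sin (2 * \<kappa> * \<xi> b) / (4 * \<kappa>)\<bar> \<le> 1 / 4 / \<kappa>"
      using l by (simp add: abs_divide divide_right_mono)
    then have "\<bar>integral {a..b} f - \<xi> b / 2\<bar> \<le> E * \<xi> b + 1 / 4 / \<kappa>"
      using 1 unfolding h_def by linarith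
    also have "\<dots> = (C * (C + 2) * \<xi> b + 1/4) / \<kappa>"
      by (simp add: E_def add_divide_distrib)
    also have "integral {a..b} f = integral {a..b} (\<lambda>r. (\<kappa> * B a)\<^sup>2 * (\<rho> r * U (\<kappa>\<^sup>2) r * U (\<kappa>\<^sup>2) r))"
      by (rule integral_cong)
        (simp add: f_def u_def rho_eq power_mult_distrib power2_eq_square mult_ac)
    also have "\<dots> = (\<kappa> * B a)\<^sup>2 * integral {a..b} (\<lambda>r. \<rho> r * U (\<kappa>\<^sup>2) r * U (\<kappa>\<^sup>2) r)"
      by (rule integral_mult_right)
    finally show "\<bar>(\<kappa> * B a)\<^sup>2 * integral {a..b} (\<lambda>r. \<rho> r * U (\<kappa>\<^sup>2) r * U (\<kappa>\<^sup>2) r) - \<xi> b / 2\<bar>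
        \<le> (C * (C + 2) * \<xi> b + 1/4) / \<kappa>" .
  qed (use C \<xi>_right_pos in auto)
qed

text \<open>The angle condition gives an error A / \<open>lam m\<close>, which is bounded by A /
  \<open>lam 1\<close>. That already forces linear growth, and inserting it turns the error into
  O(1/m).\<close>

theorem eigenvalue_asymptotics:
  assumes pos: "\<And>m. 1 \<le> m \<Longrightarrow> 0 < lam m"
    and sys: "sl_eigensystem p \<rho> a b (\<lambda>m. (lam m)\<^sup>2) R"
  obtains A c M where "0 < c" "0 \<le> A" "1 \<le> M"
    "\<And>m. M \<le> m \<Longrightarrow> c * real m \<le> lam m"
    "\<And>m. M \<le> m \<Longrightarrow> \<bar>lam m - pi * real m / \<xi> b\<bar> \<le> A / real m"
proof -
  note L = \<xi>_right_pos
  obtain Q where Q: "0 \<le> Q" "\<And>r. r \<in> {a..b} \<Longrightarrow> \<bar>q r * \<omega> r\<bar> \<le> Q" using q\<omega>_bound by blast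
  define A where "A = Q * (b - a) / \<xi> b"
  have A: "0 \<le> A" using Q ab L by (simp add: A_def)
  have near: "\<bar>lam m - pi * real m / \<xi> b\<bar> \<le> A / lam m" if m: "1 \<le> m" for m
  proof -
    have "\<bar>real m * pi - lam m * \<xi> b\<bar> \<le> Q / lam m * (b - a)"
      using \<Theta>_approx[OF pos[OF m] Q(2), of b] \<Theta>_right_eigenvalue[OF pos sys m] ab by simp
    then have "\<bar>real m * pi - lam m * \<xi> b\<bar> / \<xi> b \<le> Q / lam m * (b - a) / \<xi> b"
      using L by (intro divide_right_mono) auto
    moreover have "\<bar>real m * pi - lam m * \<xi> b\<bar> / \<xi> b = \<bar>lam m - pi * real m / \<xi> b\<bar>"
    proof -
      have "lam m - pi * real m / \<xi> b = - (real m * pi - lam m * \<xi> b) / \<xi> b"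
        using L by (simp add: field_simps)
      then show ?thesis using L by (simp only: abs_divide abs_minus_cancel abs_of_pos)
    qed
    ultimately show ?thesis by (simp add: A_def mult_ac)
  qed
  \<comment> \<open>Half of the limiting slope; the other half absorbs the error as soon as m is at
    least \<open>M\<close>.\<close>
  define c where "c = pi / (2 * \<xi> b)"
  have c: "0 < c" using L by (simp add: c_def)
  define M where "M = max 1 (nat \<lceil>A / lam 1 / c\<rceil>)"
  have lower: "c * real m \<le> lam m" if m: "M \<le> m" for m
  proof -
    have m1: "1 \<le> m" using m by (simp add: M_def)
    have "A / lam 1 / c \<le> real m" using m by (simp add: M_def nat_ceiling_le_eq)
    then have "A / lam 1 \<le> c * real m" by (simp only: pos_divide_le_eq[OF c] mult.commute)
    moreover have "A / lam m \<le> A / lam 1"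
      using eigensystem_mono[OF pos sys order_refl m1] pos[of 1] A by (intro divide_left_mono) auto
    moreover have "pi * real m / \<xi> b = 2 * (c * real m)" by (simp add: c_def)
    ultimately show ?thesis using near[OF m1] by linarith
  qed
  show thesis
  proof (rule that[OF c, of "A / c" M])
    fix m assume m: "M \<le> m"
    then have m1: "1 \<le> m" by (simp add: M_def)
    have "A / lam m \<le> A / (c * real m)"
      using lower[OF m] A c m1 pos[OF m1] by (intro divide_left_mono) auto
    then show "\<bar>lam m - pi * real m / \<xi> b\<bar> \<le> A / c / real m" using near[OF m1] by simp
  qed (use A c lower in \<open>auto simp: M_def\<close>)
qed

text \<open>Write \<open>R m\<close> as \<open>d m\<close> times \<open>U\<close>. Orthonormality
  determines the modulus of \<open>d m\<close> but not its phase, so the phase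
  \<open>\<sigma> m\<close> stays in the statement; \<open>e m\<close> instead divides
  \<open>d m\<close> out altogether.\<close>

theorem eigenfunction_asymptotics:
  assumes pos: "\<And>m. 1 \<le> m \<Longrightarrow> 0 < lam m"
    and sys: "sl_eigensystem p \<rho> a b (\<lambda>m. (lam m)\<^sup>2) R"
  obtains e \<sigma> K where
    "\<And>m. e m \<noteq> 0" "\<And>m. norm (\<sigma> m) = 1"
    "\<And>m. \<forall>r\<in>{a..b}. R m r \<in> \<real> \<Longrightarrow> \<sigma> m \<in> \<real>"
    "\<forall>\<^sub>F m in sequentially. \<forall>r\<in>{a..b}.
      norm (e m * R m r - complex_of_real (1 / B r * sin (lam m * \<xi> r))) \<le> K / real m"
    "\<forall>\<^sub>F m in sequentially. \<forall>r\<in>{a..b}.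
      norm (R m r - \<sigma> m * complex_of_real
        (sqrt (2 / \<xi> b) * (1 / B r) * sin (pi * real m / \<xi> b * \<xi> r))) \<le> K / real m"
proof -
  define L where "L = \<xi> b"
  have L: "0 < L" using \<xi>_right_pos by (simp add: L_def)
  have Ba: "0 < B a" using B_pos[of a] ab by simp
  obtain A c M where A: "0 < c" "0 \<le> A" "1 \<le> M"
    "\<And>m. M \<le> m \<Longrightarrow> c * real m \<le> lam m"
    "\<And>m. M \<le> m \<Longrightarrow> \<bar>lam m - pi * real m / L\<bar> \<le> A / real m"
    using eigenvalue_asymptotics[OF pos sys] unfolding L_def by metis
  obtain C \<Lambda> where C: "0 \<le> C" "1 \<le> \<Lambda>" "\<And>\<kappa> r. \<Lambda> \<le> \<kappa> \<Longrightarrow> r \<in> {a..b} \<Longrightarrow>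
      \<bar>\<kappa> * B a * u \<kappa> r - sin (\<kappa> * \<xi> r)\<bar> \<le> C / \<kappa>" using u_asymptotics by metis
  define N where "N = (\<lambda>\<mu>. integral {a..b} (\<lambda>r. \<rho> r * U \<mu> r * U \<mu> r))"
  obtain D \<Lambda>' where D: "0 \<le> D" "1 \<le> \<Lambda>'"
    "\<And>\<kappa>. \<Lambda>' \<le> \<kappa> \<Longrightarrow>
      \<bar>(\<kappa> * B a)\<^sup>2 * integral {a..b} (\<lambda>r. \<rho> r * U (\<kappa>\<^sup>2) r * U (\<kappa>\<^sup>2) r) - \<xi> b / 2\<bar> \<le> D / \<kappa>"
    using norm_asymptotics by blast
  have "continuous_on {a..b} (\<lambda>r. 1 / B r)"
    by (intro continuous_intros cont_B) (use B_pos in fastforce)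
  then obtain \<beta> where \<beta>: "0 \<le> \<beta>" "\<And>r. r \<in> {a..b} \<Longrightarrow> \<bar>1 / B r\<bar> \<le> \<beta>"
    using continuous_on_Icc_abs_bound by blast
  have "\<exists>d. d \<noteq> 0 \<and> (\<forall>r\<in>{a..b}. R m r = d * complex_of_real (U ((lam m)\<^sup>2) r))" if "1 \<le> m" for m
  proof -
    have "sl_eigenfunction p \<rho> a b ((lam m)\<^sup>2) (R m)"
      using sys that by (simp add: sl_eigensystem_def)
    then show ?thesis using eigenfunction_eq by metis
  qed
  then obtain d where d: "\<And>m. 1 \<le> m \<Longrightarrow> d m \<noteq> 0"
    "\<And>m r. 1 \<le> m \<Longrightarrow> r \<in> {a..b} \<Longrightarrow> R m r = d m * complex_of_real (U ((lam m)\<^sup>2) r)"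
    by metis
  have N_pos: "0 < N \<mu>" for \<mu> using norm_U_pos[of \<mu>] by (simp add: N_def)
  have norm_d: "norm (d m) = 1 / sqrt (N ((lam m)\<^sup>2))" if m: "1 \<le> m" for m
  proof -
    have "d m * cnj (d m) * complex_of_real (N ((lam m)\<^sup>2)) = 1"
      using weighted_inner_UU[OF d(2)[OF m] d(2)[OF m]] sys m by (simp add: sl_eigensystem_def N_def)
    then have "complex_of_real ((norm (d m))\<^sup>2 * N ((lam m)\<^sup>2)) = complex_of_real 1"
      by (simp only: complex_norm_square of_real_mult of_real_1)
    then have "(norm (d m))\<^sup>2 = 1 / N ((lam m)\<^sup>2)"
      using N_pos[of "(lam m)\<^sup>2"] by (simp only: of_real_eq_iff) (simp add: field_simps)
    then have "sqrt ((norm (d m))\<^sup>2) = sqrt (1 / N ((lam m)\<^sup>2))" by simp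
    then show ?thesis by (simp add: real_sqrt_divide)
  qed
  \<comment> \<open>The value 1 at index 0, here and for \<sigma>, makes the claims on all m true
    although nothing is known about \<open>d 0\<close>.\<close>
  define e where "e = (\<lambda>m. if 1 \<le> m then complex_of_real (lam m * B a) / d m else 1)"
  define \<sigma> where "\<sigma> = (\<lambda>m. if 1 \<le> m then sgn (d m) else 1)"
  define X where "X = (\<lambda>m r. lam m * B a * u (lam m) r)"
  \<comment> \<open>The squared norm of the scaled solution \<open>X m r / B r\<close>; it tends to
    L / 2, so its inverse root tends to \<open>S\<close>.\<close>
  define J where "J = (\<lambda>m. (lam m * B a)\<^sup>2 * N ((lam m)\<^sup>2))"
  have J_pos: "0 < J m" if "1 \<le> m" for m
    using pos[OF that] Ba N_pos by (simp add: J_def)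
  have eR: "e m * R m r = complex_of_real (1 / B r * X m r)" if "1 \<le> m" "r \<in> {a..b}" for m r
    using d[OF that(1)] that B_pos[OF that(2)] by (simp add: e_def X_def u_def)
  have R_eq: "R m r = \<sigma> m * complex_of_real (1 / sqrt (J m) * (1 / B r) * X m r)"
    if m: "1 \<le> m" and r: "r \<in> {a..b}" for m r
  proof -
    have "1 / sqrt (J m) * (1 / B r) * X m r = norm (d m) * U ((lam m)\<^sup>2) r"
      using pos[OF m] Ba B_pos[OF r] N_pos[of "(lam m)\<^sup>2"]
      by (simp add: J_def norm_d[OF m] X_def u_def real_sqrt_mult)
    moreover have "d m = \<sigma> m * complex_of_real (norm (d m))"
      using m d(1)[OF m] by (simp add: \<sigma>_def sgn_eq)
    ultimately show ?thesis using d(2)[OF m r] by simp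
  qed
  have \<sigma>_real: "\<sigma> m \<in> \<real>" if R: "\<forall>r\<in>{a..b}. R m r \<in> \<real>" for m
  proof (cases "1 \<le> m")
    case True
    obtain r where r: "r \<in> {a..b}" "U ((lam m)\<^sup>2) r \<noteq> 0" using U_not_all_zero by blast
    then have "d m = R m r / complex_of_real (U ((lam m)\<^sup>2) r)" using d(2)[OF True] by simp
    then have "d m \<in> \<real>" using R r by simp
    then show ?thesis using True by (simp add: \<sigma>_def sgn_eq)
  qed (simp add: \<sigma>_def)
  define S where "S = sqrt (2 / L)"
  have S: "S = 1 / sqrt (L / 2)" "0 \<le> S" using L by (simp_all add: S_def real_sqrt_divide)
  \<comment> \<open>\<open>D\<close> times a Lipschitz constant of the inverse square root on values
    at least L / 4.\<close>
  define H where "H = D / (L / 4 * sqrt (L / 4))"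
  have H: "0 \<le> H" using D L by (simp add: H_def)
  have "filterlim (\<lambda>m. c * real m) at_top sequentially"
    by (rule filterlim_tendsto_pos_mult_at_top[OF tendsto_const A(1) filterlim_real_sequentially])
  then have large: "eventually (\<lambda>m. Z \<le> c * real m) sequentially" for Z
    by (simp add: filterlim_at_top)
  \<comment> \<open>The threshold 4 D / L brings the error of \<open>J m\<close> below L / 4, so
    that \<open>J m\<close> is at least L / 4.\<close>
  have ev: "eventually (\<lambda>m. M \<le> m \<and> max (max \<Lambda> \<Lambda>') (4 * D / L) \<le> lam m) sequentially"
    using large[of "max (max \<Lambda> \<Lambda>') (4 * D / L)"] eventually_ge_at_top[of M]
    by eventually_elim (use A(4) in \<open>force intro: order_trans\<close>)
  define K1 where "K1 = \<beta> * (C / c)"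
  \<comment> \<open>The summands belong to the normalising factor, to the approximation of u by a
    sine, and to replacing \<open>lam m\<close> by pi m / L in that sine, in the order of the terms
    of \<open>Y\<close> below.\<close>
  define K2 where "K2 = \<beta> * (H * (1 + C) / c + S * (C / c) + S * (A * L))"
  have K: "0 \<le> K1" "0 \<le> K2" using \<beta> A C H S L by (simp_all add: K1_def K2_def)
  have main: "norm (e m * R m r - complex_of_real (1 / B r * sin (lam m * \<xi> r))) \<le> K1 / real m \<and>
      norm (R m r - \<sigma> m * complex_of_real (S * (1 / B r) * sin (pi * real m / L * \<xi> r))) \<le> K2 / real m"
    if m: "M \<le> m" and large: "max (max \<Lambda> \<Lambda>') (4 * D / L) \<le> lam m" and r: "r \<in> {a..b}" for m r
  proof -
    have m1: "1 \<le> m" using m A by simp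
    have l1: "1 \<le> lam m" using large C by simp
    have inv: "Z / lam m \<le> Z / c / real m" if "0 \<le> Z" for Z
    proof -
      have "Z / lam m \<le> Z / (c * real m)"
        using A(4)[OF m] that A(1) m1 l1 by (intro divide_left_mono) auto
      then show ?thesis by simp
    qed
    define s where "s = sin (lam m * \<xi> r)"
    define s' where "s' = sin (pi * real m / L * \<xi> r)"
    have Xs: "\<bar>X m r - s\<bar> \<le> C / lam m"
      using C(3)[OF _ r, of "lam m"] large by (simp add: X_def s_def)
    have "C / lam m \<le> C" using C l1 by (simp add: divide_le_eq mult_le_cancel_left1)
    then have X1: "\<bar>X m r\<bar> \<le> 1 + C" using Xs abs_sin_le_one[of "lam m * \<xi> r"] unfolding s_def by linarith
    have "s - s' \<le> \<bar>lam m * \<xi> r - pi * real m / L * \<xi> r\<bar>" "s' - s \<le> \<bar>lam m * \<xi> r - pi * real m / L * \<xi> r\<bar>"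
      using abs_sin_diff_le[of "lam m * \<xi> r" "pi * real m / L * \<xi> r"] by (simp_all add: s_def s'_def)
    moreover have "\<bar>lam m * \<xi> r - pi * real m / L * \<xi> r\<bar> = \<bar>lam m - pi * real m / L\<bar> * \<bar>\<xi> r\<bar>"
      by (simp add: left_diff_distrib flip: abs_mult)
    moreover have "\<dots> \<le> A / real m * L"
    proof (intro mult_mono A(5)[OF m])
      have "\<xi> a \<le> \<xi> r" "\<xi> r \<le> \<xi> b"
        using nonneg_deriv_imp_le[OF \<xi>_deriv less_imp_le[OF \<omega>_pos]] r by auto
      then show "\<bar>\<xi> r\<bar> \<le> L" by (simp add: \<xi>_left L_def)
    qed (use A in auto)
    ultimately have ss: "\<bar>s - s'\<bar> \<le> A * L / real m" by (simp add: abs_le_iff)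
    have JL: "\<bar>J m - L / 2\<bar> \<le> D / lam m" using D(3)[of "lam m"] large by (simp add: J_def N_def L_def)
    moreover have "D / lam m \<le> L / 4" using large L l1 by (simp add: field_simps)
    ultimately have "L / 4 \<le> J m" by linarith
    then have "\<bar>1 / sqrt (J m) - S\<bar> \<le> \<bar>J m - L / 2\<bar> / (L / 4 * sqrt (L / 4))"
      unfolding S(1) using L by (intro abs_inverse_sqrt_diff_le) auto
    also have "\<dots> \<le> D / lam m / (L / 4 * sqrt (L / 4))"
      using JL L by (intro divide_right_mono) auto
    finally have JS: "\<bar>1 / sqrt (J m) - S\<bar> \<le> H / lam m" by (simp add: H_def mult_ac)
    have "\<bar>1 / B r * X m r - 1 / B r * s\<bar> = \<bar>1 / B r\<bar> * \<bar>X m r - s\<bar>"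
      by (simp only: right_diff_distrib flip: abs_mult)
    also have "\<dots> \<le> \<beta> * (C / c / real m)"
      using Xs inv[OF C(1)] \<beta> r by (intro mult_mono) auto
    also have "\<dots> = K1 / real m" by (simp add: K1_def)
    finally have 1: "\<bar>1 / B r * X m r - 1 / B r * s\<bar> \<le> K1 / real m" .
    define Y where "Y = (1 / sqrt (J m) - S) * X m r + S * (X m r - s) + S * (s - s')"
    have Y: "1 / sqrt (J m) * (1 / B r) * X m r - S * (1 / B r) * s' = 1 / B r * Y"
    proof -
      have "j * y * x - S * y * t = y * ((j - S) * x + S * (x - s) + S * (s - t))" for j y x t
        by (simp add: algebra_simps)
      then show ?thesis unfolding Y_def .
    qed
    have "\<bar>Y\<bar> \<le> \<bar>1 / sqrt (J m) - S\<bar> * \<bar>X m r\<bar> + S * \<bar>X m r - s\<bar> + S * \<bar>s - s'\<bar>"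
    proof -
      have "\<bar>x + y + z\<bar> \<le> \<bar>x\<bar> + \<bar>y\<bar> + \<bar>z\<bar>" for x y z :: real by linarith
      from this[of "(1 / sqrt (J m) - S) * X m r" "S * (X m r - s)" "S * (s - s')"]
      show ?thesis unfolding Y_def abs_mult abs_of_nonneg[OF S(2)] .
    qed
    also have "\<dots> \<le> H / c / real m * (1 + C) + S * (C / c / real m) + S * (A * L / real m)"
      using order_trans[OF JS inv[OF H]] X1 order_trans[OF Xs inv[OF C(1)]] ss S H A(1)
      by (intro add_mono mult_mono) auto
    finally have Yle: "\<bar>Y\<bar> \<le> H / c / real m * (1 + C) + S * (C / c / real m) + S * (A * L / real m)" .
    have "\<bar>1 / B r * Y\<bar> \<le> \<beta> * (H / c / real m * (1 + C) + S * (C / c / real m) + S * (A * L / real m))"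
      unfolding abs_mult using Yle \<beta> r by (intro mult_mono) auto
    also have "\<dots> = K2 / real m" by (simp add: K2_def divide_inverse algebra_simps)
    finally have 2: "\<bar>1 / B r * Y\<bar> \<le> K2 / real m" .
    have "norm (\<sigma> m) = 1" using d(1)[OF m1] by (simp add: \<sigma>_def norm_sgn)
    then have "norm (R m r - \<sigma> m * complex_of_real (S * (1 / B r) * s')) = \<bar>1 / B r * Y\<bar>"
      unfolding R_eq[OF m1 r] right_diff_distrib[symmetric] of_real_diff[symmetric] Y norm_mult
      by (simp only: norm_of_real mult_1)
    moreover have "norm (e m * R m r - complex_of_real (1 / B r * s)) = \<bar>1 / B r * X m r - 1 / B r * s\<bar>"
      unfolding eR[OF m1 r] of_real_diff[symmetric] by (simp only: norm_of_real)
    ultimately show ?thesis using 1 2 by (simp add: s_def s'_def)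
  qed
  have le: "K1 / real m \<le> (K1 + K2) / real m" "K2 / real m \<le> (K1 + K2) / real m" for m
    using K by (simp_all add: divide_right_mono)
  show thesis
  proof (rule that[of e \<sigma> "K1 + K2"])
    show "e m \<noteq> 0" for m using d(1)[of m] pos[of m] Ba by (cases "1 \<le> m") (simp_all add: e_def)
    show "norm (\<sigma> m) = 1" for m using d(1)[of m] by (simp add: \<sigma>_def norm_sgn)
    show "\<forall>\<^sub>F m in sequentially. \<forall>r\<in>{a..b}.
        norm (e m * R m r - complex_of_real (1 / B r * sin (lam m * \<xi> r))) \<le> (K1 + K2) / real m"
      using ev by eventually_elim (use main le in \<open>blast intro: order_trans\<close>)
    show "\<forall>\<^sub>F m in sequentially. \<forall>r\<in>{a..b}.
        norm (R m r - \<sigma> m * complex_of_real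
          (sqrt (2 / \<xi> b) * (1 / B r) * sin (pi * real m / \<xi> b * \<xi> r))) \<le> (K1 + K2) / real m"
      using ev unfolding S_def[symmetric] L_def[symmetric]
      by eventually_elim (use main le in \<open>blast intro: order_trans\<close>)
  qed (use \<sigma>_real in blast)
qed

end

section \<open>The coefficients of the problem\<close>

lemma p_rho_eq:
  assumes "r0 \<noteq> 0" "r \<noteq> 0"
  shows "p_coeff r * rho_weight r0 r = 1 / r0\<^sup>2 - 1 / r\<^sup>2"
  using assms by (simp add: p_coeff_def rho_weight_def field_simps power2_eq_square)

lemma rho_over_p_eq:
  assumes "r \<noteq> 0"
  shows "rho_weight r0 r / p_coeff r = r\<^sup>2 / r0\<^sup>2 - 1"
  using assms by (simp add: p_coeff_def rho_weight_def)

lemma inverse_square_diff_pos: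
  assumes "0 < r0" "r0 < (r :: real)"
  shows "0 < 1 / r0\<^sup>2 - 1 / r\<^sup>2"
proof -
  have "r0\<^sup>2 < r\<^sup>2" using assms by (intro power_strict_mono) auto
  then show ?thesis using assms by (simp add: frac_less2)
qed

lemma inverse_square_diff_powr_deriv:
  assumes "0 < r0" "r0 < r"
  shows "((\<lambda>r. (1 / r0\<^sup>2 - 1 / r\<^sup>2) powr e) has_real_derivative
    2 * e * (1 / r0\<^sup>2 - 1 / r\<^sup>2) powr (e - 1) / r ^ 3) (at r within A)"
proof -
  have "((\<lambda>r. 1 / r0\<^sup>2 - 1 / r\<^sup>2) has_real_derivative 2 / r ^ 3) (at r)"
    using assms by (auto intro!: derivative_eq_intros simp: field_simps power2_eq_square power3_eq_cube)
  from DERIV_fun_powr[OF this inverse_square_diff_pos[OF assms], of e]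
  have "((\<lambda>r. (1 / r0\<^sup>2 - 1 / r\<^sup>2) powr e) has_real_derivative
      2 * e * (1 / r0\<^sup>2 - 1 / r\<^sup>2) powr (e - 1) / r ^ 3) (at r)"
    by (rule DERIV_cong) simp
  then show ?thesis by (rule has_field_derivative_at_within)
qed

text \<open>With S the root of the difference of squares, the logarithm has derivative 1 / S because
  1 + r / S = (r + S) / S. The numerator that remains is twice the square of S.\<close>

lemma w_fun_deriv:
  assumes "0 < r0" "r0 < r"
  shows "(w_fun r0 has_real_derivative sqrt (r\<^sup>2 / r0\<^sup>2 - 1)) (at r within A)"
proof -
  define S where "S = (\<lambda>r. sqrt (r\<^sup>2 - r0\<^sup>2))"
  have S_eq: "sqrt (r\<^sup>2 / r0\<^sup>2 - 1) = S r / r0" for r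
  proof -
    have "r\<^sup>2 / r0\<^sup>2 - 1 = (r\<^sup>2 - r0\<^sup>2) / r0\<^sup>2" using assms by (simp add: diff_divide_distrib)
    then show ?thesis using assms by (simp add: S_def real_sqrt_divide)
  qed
  have pos: "0 < r\<^sup>2 - r0\<^sup>2" using assms by (simp add: power_strict_mono)
  then have S: "0 < S r" "S r * S r = r * r - r0 * r0" by (simp_all add: S_def power2_eq_square)
  have S': "(S has_real_derivative r / S r) (at r)"
    unfolding S_def using pos by (auto intro!: derivative_eq_intros simp: field_simps)
  have "w_fun r0 = (\<lambda>r. (1/2) * (r * (S r / r0) - r0 * ln ((r + S r) / r0)))"
    by (simp add: fun_eq_iff w_fun_def S_eq S_def)
  moreover have "((\<lambda>r. (1/2) * (r * (S r / r0) - r0 * ln ((r + S r) / r0))) has_real_derivative S r / r0) (at r)"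
  proof -
    have "((\<lambda>r. (r + S r) / r0) has_real_derivative (1 + r / S r) / r0) (at r)"
      by (intro DERIV_cdivide DERIV_add DERIV_ident S')
    moreover have "0 < (r + S r) / r0" using assms S(1) by simp
    ultimately have "((\<lambda>r. ln ((r + S r) / r0)) has_real_derivative
        inverse ((r + S r) / r0) * ((1 + r / S r) / r0)) (at r)"
      by (intro DERIV_chain2[OF DERIV_ln])
    moreover have "inverse ((r + S r) / r0) * ((1 + r / S r) / r0) = 1 / S r"
    proof -
      have "1 + r / S r = (r + S r) / S r" using S(1) by (simp add: add_divide_distrib)
      moreover have "0 < r + S r" using assms S(1) by simp
      ultimately show ?thesis using assms by simp
    qed
    ultimately have "((\<lambda>r. ln ((r + S r) / r0)) has_real_derivative 1 / S r) (at r)" by simp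
    then have hd: "((\<lambda>r. (1/2) * (r * (S r / r0) - r0 * ln ((r + S r) / r0))) has_real_derivative
        (1/2) * ((1 * (S r / r0) + r / S r / r0 * r) - r0 * (1 / S r))) (at r)"
      by (intro DERIV_cmult DERIV_diff DERIV_mult DERIV_ident DERIV_cdivide S')
    have e1: "(1/2) * ((1 * (S r / r0) + r / S r / r0 * r) - r0 * (1 / S r))
        = (1/2) * ((S r * S r + r * r - r0 * r0) / (S r * r0))"
      using assms S(1) by (simp add: field_simps)
    have "S r * S r + r * r - r0 * r0 = 2 * (S r * S r)" using S(2) by simp
    then have e2: "(1/2) * ((S r * S r + r * r - r0 * r0) / (S r * r0)) = S r / r0"
      by (simp only:) (use S(1) in simp)
    show ?thesis by (rule DERIV_cong[OF hd trans[OF e1 e2]])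
  qed
  ultimately show ?thesis by (simp add: S_eq has_field_derivative_at_within)
qed

lemma xi_fun_eq:
  assumes "0 < r0" "r0 < r1" "r1 \<le> r"
  shows "xi_fun r0 r1 r = w_fun r0 r - w_fun r0 r1"
proof -
  have "((\<lambda>s. sqrt (rho_weight r0 s / p_coeff s)) has_integral w_fun r0 r - w_fun r0 r1) {r1..r}"
  proof (rule fundamental_theorem_of_calculus[OF assms(3)])
    fix s assume "s \<in> {r1..r}"
    then have s: "r0 < s" "s \<noteq> 0" using assms by auto
    show "(w_fun r0 has_vector_derivative sqrt (rho_weight r0 s / p_coeff s)) (at s within {r1..r})"
      using w_fun_deriv[OF assms(1) s(1)]
      by (simp add: rho_over_p_eq[OF s(2)] has_real_derivative_iff_has_vector_derivative)
  qed
  then show ?thesis unfolding xi_fun_def by (rule integral_unique)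
qed

text \<open>The product of the coefficients is s, with derivative 2 / r^3, and r0 < r1 keeps s
  positive up to the boundary. The two formulas are the derivatives of s^(1/4) and of g = s^(-5/4) /
  (2 r^4).\<close>

lemma liouville_sl_annulus:
  assumes "0 < r0" "r0 < r1" "r1 < r2"
  defines "s \<equiv> \<lambda>r. 1 / r0\<^sup>2 - 1 / r\<^sup>2"
  shows "liouville_sl r1 r2 p_coeff (rho_weight r0) (\<lambda>r. s r powr (- 3/4) / (2 * r ^ 3))
    (\<lambda>r. - (5/4) * s r powr (- 9/4) / r ^ 7 - 2 * s r powr (- 5/4) / r ^ 5)"
proof
  note pos = inverse_square_diff_pos[OF assms(1)]
  have r: "0 < r" "r0 < r" if "r \<in> {r1..r2}" for r using that assms by auto
  show "r1 < r2" by fact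
  show "continuous_on {r1..r2} p_coeff" unfolding p_coeff_def[abs_def]
    by (intro continuous_intros) (use assms in auto)
  show "continuous_on {r1..r2} (rho_weight r0)" unfolding rho_weight_def[abs_def]
    by (intro continuous_intros) (use assms in auto)
  show pp: "0 < p_coeff r" if "r \<in> {r1..r2}" for r using r(1)[OF that] by (simp add: p_coeff_def)
  have p\<rho>: "p_coeff r * rho_weight r0 r = s r" if "r \<in> {r1..r2}" for r
    using p_rho_eq[of r0 r] r[OF that] assms by (simp add: s_def)
  have s: "0 < s r" if "r \<in> {r1..r2}" for r using pos[OF r(2)[OF that]] by (simp add: s_def)
  show "0 < rho_weight r0 r" if "r \<in> {r1..r2}" for r
    using s[OF that] pp[OF that] by (simp add: zero_less_mult_iff flip: p\<rho>[OF that])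
  have s_powr: "((\<lambda>r. s r powr e) has_real_derivative 2 * e * s r powr (e - 1) / r ^ 3) (at r within A)"
    if "r \<in> {r1..r2}" for r e A
    unfolding s_def by (rule inverse_square_diff_powr_deriv[OF assms(1) r(2)[OF that]])
  show "((\<lambda>r. (p_coeff r * rho_weight r0 r) powr (1/4)) has_real_derivative s r powr (- 3/4) / (2 * r ^ 3))
      (at r within {r1..r2})" if "r \<in> {r1..r2}" for r
  proof (rule has_field_derivative_transform_within[OF _ zero_less_one that])
    show "((\<lambda>r. s r powr (1/4)) has_real_derivative s r powr (- 3/4) / (2 * r ^ 3)) (at r within {r1..r2})"
      using s_powr[OF that, of "1/4" "{r1..r2}"] by simp
  qed (simp add: p\<rho>)
  have g: "p_coeff r * (s r powr (- 3/4) / (2 * r ^ 3)) / sqrt (p_coeff r * rho_weight r0 r)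
      = s r powr (- 5/4) / (2 * r ^ 4)" if "r \<in> {r1..r2}" for r
  proof -
    have 1: "s r powr (- 3/4) / sqrt (s r) = s r powr (- 5/4)"
      using powr_diff[of "s r" "- 3/4" "1/2"] s[OF that] by (simp add: powr_half_sqrt)
    have 2: "1 / r * (X / (2 * r ^ 3)) / Y = X / Y / (2 * r ^ 4)" for X Y
      by (simp add: power3_eq_cube power4_eq_xxxx mult_ac)
    show ?thesis
      unfolding p\<rho>[OF that] unfolding p_coeff_def 2 1 ..
  qed
  show "((\<lambda>r. p_coeff r * (s r powr (- 3/4) / (2 * r ^ 3)) / sqrt (p_coeff r * rho_weight r0 r))
      has_real_derivative - (5/4) * s r powr (- 9/4) / r ^ 7 - 2 * s r powr (- 5/4) / r ^ 5)
      (at r within {r1..r2})" if "r \<in> {r1..r2}" for r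
  proof (rule has_field_derivative_transform_within[OF _ zero_less_one that])
    have rn: "r \<noteq> 0" using r(1)[OF that] by simp
    have "((\<lambda>r. s r powr (- 5/4) / (2 * r ^ 4)) has_real_derivative
        (2 * (- 5/4) * s r powr (- 5/4 - 1) / r ^ 3 * (2 * r ^ 4) - s r powr (- 5/4) * (8 * r ^ 3))
          / ((2 * r ^ 4) * (2 * r ^ 4))) (at r within {r1..r2})"
      using rn by (intro DERIV_divide s_powr that) (auto intro!: derivative_eq_intros)
    then show "((\<lambda>r. s r powr (- 5/4) / (2 * r ^ 4)) has_real_derivative
        - (5/4) * s r powr (- 9/4) / r ^ 7 - 2 * s r powr (- 5/4) / r ^ 5) (at r within {r1..r2})"
    proof (rule DERIV_cong)
      have e: "(- 5/4 - 1 :: real) = - 9/4" by simp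
      have "(2 * (- 5/4) * X / r ^ 3 * (2 * r ^ 4) - Y * (8 * r ^ 3)) / ((2 * r ^ 4) * (2 * r ^ 4))
          = - (5/4) * X / r ^ 7 - 2 * Y / r ^ 5" for X Y
        using rn by (simp add: field_simps power_numeral_reduce)
      then show "(2 * (- 5/4) * s r powr (- 5/4 - 1) / r ^ 3 * (2 * r ^ 4) - s r powr (- 5/4) * (8 * r ^ 3))
          / ((2 * r ^ 4) * (2 * r ^ 4))
        = - (5/4) * s r powr (- 9/4) / r ^ 7 - 2 * s r powr (- 5/4) / r ^ 5"
        using e by (simp only:)
    qed
  qed (rule g[symmetric])
  show "continuous_on {r1..r2} (\<lambda>r. - (5/4) * s r powr (- 9/4) / r ^ 7 - 2 * s r powr (- 5/4) / r ^ 5)"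
  proof -
    have "continuous_on {r1..r2} (\<lambda>r. s r powr e)" for e
      by (rule DERIV_continuous_on[OF s_powr])
    then show ?thesis
      by (intro continuous_on_diff continuous_on_divide continuous_on_mult continuous_on_const
          continuous_on_power continuous_on_id) (use assms(1-3) in auto)
  qed
qed

text \<open>The leading asymptotics is read as uniform smallness of a difference, since a quotient
  is meaningless at zeros of the sine; the factors \<open>c m\<close> express the free
  normalisation. In the sharp form only a phase is free, and for real eigenfunctions it is a
  sign.\<close>

theorem mainTheorem5:
  fixes r0 r1 r2 L :: real
    and lam :: "nat \<Rightarrow> real"
    and R :: "nat \<Rightarrow> real \<Rightarrow> complex"
  assumes "0 < r0" and "r0 < r1" and "r1 < r2"
    and lam_pos: "\<forall>m\<ge>1. 0 < lam m"
    and eigensystem: "sl_eigensystem p_coeff (rho_weight r0) r1 r2 (\<lambda>m. (lam m)^2) R"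
    and L: "L = xi_fun r0 r1 r2"
  shows "(\<forall>r\<in>{r1..r2}. xi_fun r0 r1 r = w_fun r0 r - w_fun r0 r1)
    \<and> L = w_fun r0 r2 - w_fun r0 r1
    \<and> (\<lambda>m. lam m - pi * real m / L) \<in> O(\<lambda>m. 1 / real m)
    \<and> (\<exists>c :: nat \<Rightarrow> complex. (\<forall>m. c m \<noteq> 0) \<and>
         uniform_limit {r1..r2}
           (\<lambda>m r. c m * R m r
                  - complex_of_real (amplitude r0 r * sin (lam m * xi_fun r0 r1 r)))
           (\<lambda>r. 0) sequentially)
    \<and> (\<exists>\<sigma> :: nat \<Rightarrow> complex.
         (\<forall>m. norm (\<sigma> m) = 1) \<and>
         (\<forall>m. (\<forall>r\<in>{r1..r2}. R m r \<in> \<real>) \<longrightarrow> \<sigma> m \<in> \<real>) \<and>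
         (\<exists>C. \<forall>\<^sub>F m in sequentially. \<forall>r\<in>{r1..r2}.
            norm (R m r - \<sigma> m * complex_of_real
                    (sqrt (2 / L) * amplitude r0 r * sin (pi * real m / L * xi_fun r0 r1 r)))
              \<le> C / real m))"
proof -
  interpret liouville_sl r1 r2 p_coeff "rho_weight r0"
    "\<lambda>r. (1 / r0\<^sup>2 - 1 / r\<^sup>2) powr (- 3/4) / (2 * r ^ 3)"
    "\<lambda>r. - (5/4) * (1 / r0\<^sup>2 - 1 / r\<^sup>2) powr (- 9/4) / r ^ 7 - 2 * (1 / r0\<^sup>2 - 1 / r\<^sup>2) powr (- 5/4) / r ^ 5"
    using assms(1-3) by (rule liouville_sl_annulus)
  have pos: "0 < lam m" if "1 \<le> m" for m using lam_pos that by simp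
  have \<xi>: "\<xi> = xi_fun r0 r1" by (simp add: fun_eq_iff \<xi>_def xi_fun_def \<omega>_def[abs_def])
  have amp: "1 / B r = amplitude r0 r" for r by (simp add: B_def amplitude_def)
  have xi: "xi_fun r0 r1 r = w_fun r0 r - w_fun r0 r1" if "r \<in> {r1..r2}" for r
    using xi_fun_eq[of r0 r1 r] assms that by simp
  have lam: "(\<lambda>m. lam m - pi * real m / L) \<in> O(\<lambda>m. 1 / real m)"
  proof -
    obtain A c M where "0 < c" "0 \<le> A" "1 \<le> M" "\<And>m. M \<le> m \<Longrightarrow> c * real m \<le> lam m"
      and A: "\<And>m. M \<le> m \<Longrightarrow> \<bar>lam m - pi * real m / L\<bar> \<le> A / real m"
      by (rule eigenvalue_asymptotics[OF pos eigensystem, unfolded \<xi> L[symmetric]], assumption)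
        (rule that)
    show ?thesis
      by (rule bigoI[of _ A]) (use A in \<open>auto simp: eventually_at_top_linorder intro!: exI[of _ M]\<close>)
  qed
  obtain e \<sigma> K where e: "\<And>m. e m \<noteq> 0" and \<sigma>: "\<And>m. norm (\<sigma> m) = 1"
    "\<And>m. \<forall>r\<in>{r1..r2}. R m r \<in> \<real> \<Longrightarrow> \<sigma> m \<in> \<real>"
    and lead: "\<forall>\<^sub>F m in sequentially. \<forall>r\<in>{r1..r2}.
      norm (e m * R m r - complex_of_real (amplitude r0 r * sin (lam m * xi_fun r0 r1 r))) \<le> K / real m"
    and orth: "\<forall>\<^sub>F m in sequentially. \<forall>r\<in>{r1..r2}.
      norm (R m r - \<sigma> m * complex_of_real
        (sqrt (2 / L) * amplitude r0 r * sin (pi * real m / L * xi_fun r0 r1 r))) \<le> K / real m"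
    by (rule eigenfunction_asymptotics[OF pos eigensystem, unfolded \<xi> amp L[symmetric]], assumption)
      (rule that)
  have "(\<lambda>m. K / real m) \<longlonglongrightarrow> 0" by (rule lim_const_over_n)
  have lead': "uniform_limit {r1..r2} (\<lambda>m r. e m * R m r
      - complex_of_real (amplitude r0 r * sin (lam m * xi_fun r0 r1 r))) (\<lambda>r. 0) sequentially"
  proof (rule uniform_limitI)
    fix \<epsilon> :: real assume "0 < \<epsilon>"
    then have "eventually (\<lambda>m. K / real m < \<epsilon>) sequentially"
      using \<open>(\<lambda>m. K / real m) \<longlonglongrightarrow> 0\<close> by (rule order_tendstoD(2)[rotated])
    with lead show "\<forall>\<^sub>F m in sequentially. \<forall>r\<in>{r1..r2}. dist (e m * R m r
        - complex_of_real (amplitude r0 r * sin (lam m * xi_fun r0 r1 r))) 0 < \<epsilon>"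
      by eventually_elim (auto simp: dist_norm intro: le_less_trans)
  qed
  show ?thesis
  proof (intro conjI)
    show "\<forall>r\<in>{r1..r2}. xi_fun r0 r1 r = w_fun r0 r - w_fun r0 r1" using xi by blast
    show "L = w_fun r0 r2 - w_fun r0 r1" using xi[of r2] assms(3) by (simp add: L)
  qed (use lam e lead' \<sigma> orth in blast)+
qed

end
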